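(* Let $\Gamma$ be an undirected graph on $n\le 7$ vertices having no multiple edges and no loops. Then: $$G_{\mathrm{aut}}(\Gamma)=\mathbb{Z}_2\quad\Longrightarrow\quad G_{\mathrm{aut}}^+(\Gamma)=\mathbb{Z}_2,$$ $$G_{\mathrm{aut}}(\Gamma)=\{e\}\quad\Longrightarrow\quad G_{\mathrm{aut}}^+(\Gamma)=\{e\}.$$ Here $G_{\mathrm{aut}}(\Gamma)$ is the automorphism group and $G_{\mathrm{aut}}^+(\Gamma)$ the quantum automorphism group of $\Gamma$, as defined in the context.
   Context: A graph $\Gamma=(V,E)$ has vertex set $V=\{1,\dots,n\}$ and edge set $E\subseteq V\times V$ (so no multiple edges). Undirected means $(i,j)\in E\Rightarrow (j,i)\in E$; no loops means $(i,i)\notin E$ for all $i$. The graph is not assumed to be connected. The adjacency matrix $\varepsilon\in M_n(\{0,1\})$ has $\varepsilon_{ij}=1$ iff $(i,j)\in E$. The automorphism group is $G_{\mathrm{aut}}(\Gamma)=\{\sigma\in S_n : \sigma\varepsilon=\varepsilon\sigma\}\subseteq S_n$, where $\sigma$ is identified with its permutation matrix. $\mathbb{Z}_2$ denotes the cyclic group of order two. A compact matrix quantum group $G=(A,u)$ consists of a unital $C^*$-algebra $A$ and a matrix $u=(u_{ij})\in M_n(A)$ such that there is a $*$-homomorphism $\Delta:A\to A\otimes A$ with $\Delta(u_{ij})=\sum_k u_{ik}\otimes u_{kj}$, both $u$ and $\bar u=(u_{ij}^* )$ are invertible, and the $u_{ij}$ generate $A$ as a $C^*$-algebra. A compact group $G\subset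 GL_n(\mathbb{C})$ is regarded as the compact matrix quantum group $(C(G),(u_{ij}))$ with $u_{ij}(g)=g_{ij}$. For $G=(A,u)$ and $H=(B,v)$ with $u\in M_n(A)$, $v\in M_n(B)$, write $G\subseteq H$ if there is a surjective unital $*$-homomorphism $B\to A$ mapping $v_{ij}\mapsto u_{ij}$; $G=H$ means $G\subseteq H$ and $H\subseteq G$. The quantum automorphism group $G_{\mathrm{aut}}^+(\Gamma)$ (in the sense of Banica) is the compact matrix quantum group $(C(G_{\mathrm{aut}}^+(\Gamma)),u)$ given by the universal unital $C^*$-algebra $$C(G_{\mathrm{aut}}^+(\Gamma))=C^*\Big\langle u_{ij},\,1\le i,j\le n\ \Big|\ u_{ij}=u_{ij}^*=u_{ij}^2,\ \sum_{k=1}^n u_{ik}=\sum_{k=1}^n u_{ki}=1\ (1\le i\le n),\ u\varepsilon=\varepsilon u\Big\rangle .$$ One always has $G_{\mathrm{aut}}(\Gamma)\subseteq G_{\mathrm{aut}}^+(\Gamma)$: the quotient of $C(G_{\mathrm{aut}}^+(\Gamma))$ by the relations $u_{ij}u_{kl}=u_{kl}u_{ij}$ is $C(G_{\mathrm{aut}}(\Gamma))$. In the claim, "$G_{\mathrm{aut}}(\Gamma)=\mathbb{Z}_2\Rightarrow G_{\mathrm{aut}}^+(\Gamma)=\mathbb{Z}_2$" means: if $G_{\mathrm{aut}}(\Gamma)$ is of order two then $G_{\mathrm{aut}}^+(\Gamma)=G_{\mathrm{aut}}(\Gamma)$ as compact matrix quantum groups, equivalently $C(G_{\mathrm{aut}}^+(\Gamma))$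 is commutative; similarly for $\{e\}$ (order one). *)

theory Defs
  imports Complex_Main "HOL-Library.Poly_Mapping" "HOL-Library.FuncSet"
    "HOL-Algebra.Module" "HOL-Algebra.Sym_Groups"
begin

record 'a star_algebra = "(complex, 'a) module" +
  star :: "'a \<Rightarrow> 'a"
  nrm :: "'a \<Rightarrow> real"

text \<open>Unital \<open>*\<close>-homomorphisms (\<^const>\<open>ring_hom\<close> includes preservation of the unit).\<close>

definition star_hom ::
  "('a, 'm) star_algebra_scheme \<Rightarrow> ('b, 'k) star_algebra_scheme \<Rightarrow> ('a \<Rightarrow> 'b) set" where
  "star_hom A B = {\<phi> \<in> ring_hom A B.
     (\<forall>c. \<forall>x\<in>carrier A. \<phi> (c \<odot>\<^bsub>A\<^esub> x) = c \<odot>\<^bsub>B\<^esub> \<phi> x) \<and>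
     (\<forall>x\<in>carrier A. \<phi> (star A x) = star B (\<phi> x))}"

text \<open>
  Noncommutative \<open>*\<close>-polynomials are finitely supported functions on words in the letters
  \<open>x\<close>, \<open>x\<^sup>*\<close>.  With concatenation as the monoid operation on words, the convolution product of
  \<^type>\<open>poly_mapping\<close> is the product of noncommutative polynomials.
\<close>

instantiation list :: (type) monoid_add
begin
definition zero_list :: "'a list" where "zero_list = []"
definition plus_list :: "'a list \<Rightarrow> 'a list \<Rightarrow> 'a list" where "plus_list = (@)"
instance by standard (simp_all add: zero_list_def plus_list_def)
end

datatype 'x letter = Gen (gen_of: 'x) | Adj (gen_of: 'x)

fun letter_star :: "'x letter \<Rightarrow> 'x letter" where
  "letter_star (Gen x) = Adj x"
| "letter_star (Adj x) = Gen x"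

type_synonym 'x star_poly = "'x letter list \<Rightarrow>\<^sub>0 complex"

definition gen_poly :: "'x \<Rightarrow> 'x star_poly" where
  "gen_poly x = Poly_Mapping.single [Gen x] 1"

definition const_poly :: "complex \<Rightarrow> 'x star_poly" where
  "const_poly c = Poly_Mapping.single [] c"

definition poly_star :: "'x star_poly \<Rightarrow> 'x star_poly" where
  "poly_star p = (\<Sum>w\<in>Poly_Mapping.keys p.
     Poly_Mapping.single (rev (map letter_star w)) (cnj (Poly_Mapping.lookup p w)))"

definition free_star_carrier :: "'x set \<Rightarrow> 'x star_poly set" where
  "free_star_carrier X = {p. \<forall>w\<in>Poly_Mapping.keys p. \<forall>l\<in>set w. gen_of l \<in> X}"

text \<open>
  The universal unital \<open>C\<^sup>*\<close>-algebra with generators \<open>X\<close> and relations \<open>R\<close> is the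
  separation and completion of the free \<open>*\<close>-algebra modulo the two-sided \<open>*\<close>-ideal generated
  by \<open>R\<close>, with respect to the supremum of all \<open>C\<^sup>*\<close>-seminorms.  A \<open>C\<^sup>*\<close>-seminorm on this
  quotient is the same as a \<open>C\<^sup>*\<close>-seminorm on the free \<open>*\<close>-algebra vanishing on \<open>R\<close>, since
  the null space of a \<open>C\<^sup>*\<close>-seminorm is a two-sided \<open>*\<close>-ideal.  Values outside
  \<^term>\<open>free_star_carrier X\<close> are irrelevant.
\<close>

definition cstar_seminorms :: "'x set \<Rightarrow> 'x star_poly set \<Rightarrow> ('x star_poly \<Rightarrow> real) set" where
  "cstar_seminorms X R = {p.
     (\<forall>a\<in>free_star_carrier X. 0 \<le> p a) \<and>
     (\<forall>c. \<forall>a\<in>free_star_carrier X. p (const_poly c * a) = cmod c * p a) \<and>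
     (\<forall>a\<in>free_star_carrier X. \<forall>b\<in>free_star_carrier X. p (a + b) \<le> p a + p b) \<and>
     (\<forall>a\<in>free_star_carrier X. \<forall>b\<in>free_star_carrier X. p (a * b) \<le> p a * p b) \<and>
     (\<forall>a\<in>free_star_carrier X. p (poly_star a * a) = (p a)\<^sup>2) \<and>
     (\<forall>r\<in>R. p r = 0)}"

text \<open>
  The real-valued supremum is meaningful when the relations bound every \<open>C\<^sup>*\<close>-seminorm uniformly.
  This is the case below, where every generator is a projection and hence has seminorm at most 1.
\<close>

definition univ_seminorm :: "'x set \<Rightarrow> 'x star_poly set \<Rightarrow> 'x star_poly \<Rightarrow> real" where
  "univ_seminorm X R a = (SUP p\<in>cstar_seminorms X R. p a)"

definition cauchy_seqs :: "'x set \<Rightarrow> 'x star_poly set \<Rightarrow> (nat \<Rightarrow> 'x star_poly) set" where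
  "cauchy_seqs X R = {s. range s \<subseteq> free_star_carrier X \<and>
     (\<forall>e>0. \<exists>N. \<forall>m\<ge>N. \<forall>k\<ge>N. univ_seminorm X R (s m - s k) < e)}"

definition null_rel ::
  "'x set \<Rightarrow> 'x star_poly set \<Rightarrow> ((nat \<Rightarrow> 'x star_poly) \<times> (nat \<Rightarrow> 'x star_poly)) set" where
  "null_rel X R = {(s, t). s \<in> cauchy_seqs X R \<and> t \<in> cauchy_seqs X R \<and>
     (\<lambda>k. univ_seminorm X R (s k - t k)) \<longlonglongrightarrow> 0}"

definition seq_class ::
  "'x set \<Rightarrow> 'x star_poly set \<Rightarrow> (nat \<Rightarrow> 'x star_poly) \<Rightarrow> (nat \<Rightarrow> 'x star_poly) set" where
  "seq_class X R s = null_rel X R `` {s}"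

definition seq_repr :: "(nat \<Rightarrow> 'x star_poly) set \<Rightarrow> nat \<Rightarrow> 'x star_poly" where
  "seq_repr a = (SOME s. s \<in> a)"

definition univ_cstar ::
  "'x set \<Rightarrow> 'x star_poly set \<Rightarrow> (nat \<Rightarrow> 'x star_poly) set star_algebra" where
  "univ_cstar X R = \<lparr>
     carrier = cauchy_seqs X R // null_rel X R,
     monoid.mult = (\<lambda>a b. seq_class X R (\<lambda>k. seq_repr a k * seq_repr b k)),
     one = seq_class X R (\<lambda>k. 1),
     zero = seq_class X R (\<lambda>k. 0),
     add = (\<lambda>a b. seq_class X R (\<lambda>k. seq_repr a k + seq_repr b k)),
     smult = (\<lambda>c a. seq_class X R (\<lambda>k. const_poly c * seq_repr a k)),
     star = (\<lambda>a. seq_class X R (\<lambda>k. poly_star (seq_repr a k))),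
     nrm = (\<lambda>a. lim (\<lambda>k. univ_seminorm X R (seq_repr a k)))\<rparr>"

definition univ_gen ::
  "'x set \<Rightarrow> 'x star_poly set \<Rightarrow> 'x \<Rightarrow> (nat \<Rightarrow> 'x star_poly) set" where
  "univ_gen X R x = seq_class X R (\<lambda>k. gen_poly x)"

text \<open>
  The data \<open>(A, u)\<close> with \<open>u \<in> M\<^sub>n(A)\<close>; only the entries with indices in \<open>{1..n}\<close> count.  The
  comultiplication is determined by \<open>(A, u)\<close> and plays no role in the comparison of two
  compact matrix quantum groups, so it is not part of the record.
\<close>

record 'a matrix_quantum_group =
  qg_size :: nat
  qg_algebra :: "'a star_algebra"
  qg_entry :: "nat \<Rightarrow> nat \<Rightarrow> 'a"

definition qg_subset ::
  "'a matrix_quantum_group \<Rightarrow> 'b matrix_quantum_group \<Rightarrow> bool" (infix \<open>\<subseteq>\<^sub>q\<close> 50) where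
  "G \<subseteq>\<^sub>q H \<longleftrightarrow> qg_size G = qg_size H \<and>
     (\<exists>\<phi> \<in> star_hom (qg_algebra H) (qg_algebra G).
        \<phi> ` carrier (qg_algebra H) = carrier (qg_algebra G) \<and>
        (\<forall>i\<in>{1..qg_size G}. \<forall>j\<in>{1..qg_size G}. \<phi> (qg_entry H i j) = qg_entry G i j))"

definition qg_equal ::
  "'a matrix_quantum_group \<Rightarrow> 'b matrix_quantum_group \<Rightarrow> bool" (infix \<open>=\<^sub>q\<close> 50) where
  "G =\<^sub>q H \<longleftrightarrow> G \<subseteq>\<^sub>q H \<and> H \<subseteq>\<^sub>q G"

definition mat_prod ::
  "nat \<Rightarrow> (nat \<Rightarrow> nat \<Rightarrow> 'a::semiring_0) \<Rightarrow> (nat \<Rightarrow> nat \<Rightarrow> 'a) \<Rightarrow> nat \<Rightarrow> nat \<Rightarrow> 'a" where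
  "mat_prod n A B i j = (\<Sum>k\<in>{1..n}. A i k * B k j)"

definition adj_matrix :: "(nat \<times> nat) set \<Rightarrow> nat \<Rightarrow> nat \<Rightarrow> 'a::zero_neq_one" where
  "adj_matrix E i j = of_bool ((i, j) \<in> E)"

text \<open>Column \<open>j\<close> of the permutation matrix of \<open>\<sigma>\<close> is the unit vector with index \<open>\<sigma> j\<close>.\<close>

definition perm_matrix :: "(nat \<Rightarrow> nat) \<Rightarrow> nat \<Rightarrow> nat \<Rightarrow> 'a::zero_neq_one" where
  "perm_matrix \<sigma> i j = of_bool (i = \<sigma> j)"

definition graph_aut :: "nat \<Rightarrow> (nat \<times> nat) set \<Rightarrow> (nat \<Rightarrow> nat) monoid" where
  "graph_aut n E = (sym_group n) \<lparr>carrier := {\<sigma> \<in> carrier (sym_group n).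
     \<forall>i\<in>{1..n}. \<forall>j\<in>{1..n}.
       mat_prod n (perm_matrix \<sigma>) (adj_matrix E) i j =
       (mat_prod n (adj_matrix E) (perm_matrix \<sigma>) i j :: complex)}\<rparr>"

text \<open>
  \<open>C(S)\<close> for a finite set \<open>S\<close>, on which every function is continuous.  Functions on \<open>S\<close> are
  represented by their extensional extensions.
\<close>

definition function_algebra :: "'s set \<Rightarrow> ('s \<Rightarrow> complex) star_algebra" where
  "function_algebra S = \<lparr>
     carrier = extensional S,
     monoid.mult = (\<lambda>f g. \<lambda>s\<in>S. f s * g s),
     one = (\<lambda>s\<in>S. 1),
     zero = (\<lambda>s\<in>S. 0),
     add = (\<lambda>f g. \<lambda>s\<in>S. f s + g s),
     smult = (\<lambda>c f. \<lambda>s\<in>S. c * f s),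
     star = (\<lambda>f. \<lambda>s\<in>S. cnj (f s)),
     nrm = (\<lambda>f. SUP s\<in>S. cmod (f s))\<rparr>"

definition perm_group_qg ::
  "nat \<Rightarrow> (nat \<Rightarrow> nat) monoid \<Rightarrow> ((nat \<Rightarrow> nat) \<Rightarrow> complex) matrix_quantum_group" where
  "perm_group_qg n G = \<lparr>
     qg_size = n,
     qg_algebra = function_algebra (carrier G),
     qg_entry = (\<lambda>i j. \<lambda>\<sigma>\<in>carrier G. perm_matrix \<sigma> i j)\<rparr>"

definition qaut_relations :: "nat \<Rightarrow> (nat \<times> nat) set \<Rightarrow> (nat \<times> nat) star_poly set" where
  "qaut_relations n E = (let u = (\<lambda>i j. gen_poly (i, j)) in
     {u i j - poly_star (u i j) | i j. i \<in> {1..n} \<and> j \<in> {1..n}} \<union>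
     {u i j - u i j * u i j | i j. i \<in> {1..n} \<and> j \<in> {1..n}} \<union>
     {(\<Sum>k\<in>{1..n}. u i k) - 1 | i. i \<in> {1..n}} \<union>
     {(\<Sum>k\<in>{1..n}. u k i) - 1 | i. i \<in> {1..n}} \<union>
     {mat_prod n u (adj_matrix E) i j - mat_prod n (adj_matrix E) u i j
       | i j. i \<in> {1..n} \<and> j \<in> {1..n}})"

definition graph_qaut ::
  "nat \<Rightarrow> (nat \<times> nat) set \<Rightarrow> (nat \<Rightarrow> (nat \<times> nat) star_poly) set matrix_quantum_group" where
  "graph_qaut n E = \<lparr>
     qg_size = n,
     qg_algebra = univ_cstar ({1..n} \<times> {1..n}) (qaut_relations n E),
     qg_entry = (\<lambda>i j. univ_gen ({1..n} \<times> {1..n}) (qaut_relations n E) (i, j))\<rparr>"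

end

theory Submission
  imports Defs
begin

text \<open>
  The universal seminorm is a supremum over all \<open>C\<^sup>*\<close>-seminorms that vanish on the relations, and
  the argument treats one such seminorm \<open>p\<close> at a time, computing in the free \<open>*\<close>-algebra up to
  elements on which \<open>p\<close> vanishes.

  The generators \<open>u i j\<close> in one row are projections with sum 1, so they are pairwise orthogonal
  (\<open>projections_orthogonal\<close>).  Because \<open>u\<close> commutes with the adjacency matrix, the equivalence
  relation generated by \<open>u i j \<noteq> 0\<close> therefore has as classes the cells of an equitable partition
  (\<open>color_equitable\<close>): two vertices in one cell have equally many neighbours in every cell.

  The combinatorial heart is that on at most seven vertices an equitable partition with a cell of
  three or more vertices forces at least three automorphisms (\<open>equitable_cell_card_le_2\<close>).  Most
  cells are joined completely or not at all to every vertex outside, and then an automorphism of the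
  regular graph induced on the cell extends by the identity.  Counting edges leaves two other cases:
  two cells of size 3 joined by a perfect matching or its complement, and a cell of size 4 that is
  split into halves by a cell of size 2.  Both have enough symmetries.

  So if the graph has at most two automorphisms, then every cell has at most two vertices, and a cell
  \<open>{x, x'}\<close> is governed by the single projection \<open>u x x'\<close>.  Comparing the entries of
  \<open>u \<epsilon> = \<epsilon> u\<close> shows that exchanging \<open>x\<close> and \<open>x'\<close> simultaneously in all cells that carry one and the
  same nonzero projection is a graph automorphism (\<open>flip_map_aut\<close>).  Two different nonzero
  projections would give two different nontrivial automorphisms; hence there is only one, \<open>q\<close>, and
  \<open>u x z = \<delta> x z (1 - q) + \<delta> x (\<tau> z) q\<close> for an automorphism \<open>\<tau>\<close> (\<open>two_point_form\<close>).  In particular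
  the entries of \<open>u\<close> commute, and \<open>p a\<close> is bounded by the absolute values of the characters
  \<open>u i j \<mapsto> \<delta> i (\<sigma> j)\<close> with \<open>\<sigma> \<in> {id, \<tau>}\<close> at \<open>a\<close> (\<open>seminorm_bound\<close>).

  Conversely the absolute value of such a character is one of the seminorms in the supremum.  The
  universal seminorm is thus equivalent to the sum of the absolute values of the characters of the
  finite automorphism group, and its completion is the algebra of functions on that group.
\<close>

section \<open>Automorphisms of regular graphs with few vertices\<close>

lemma symp_iff: "symp A \<Longrightarrow> A x y \<longleftrightarrow> A y x"
  by (auto dest: sympD)

lemma irreflp_iff: "irreflp A \<Longrightarrow> \<not> A x x"
  by (simp add: irreflp_def)

definition graph_auts :: "'a set \<Rightarrow> ('a \<Rightarrow> 'a \<Rightarrow> bool) \<Rightarrow> ('a \<Rightarrow> 'a) set" where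
  "graph_auts V A = {\<sigma>. \<sigma> permutes V \<and> (\<forall>x\<in>V. \<forall>y\<in>V. A (\<sigma> x) (\<sigma> y) \<longleftrightarrow> A x y)}"

lemma finite_graph_auts: "finite V \<Longrightarrow> finite (graph_auts V A)"
  unfolding graph_auts_def by (rule finite_subset[OF _ finite_permutations[of V]]) auto

lemma id_in_graph_auts: "id \<in> graph_auts V A"
  by (simp add: graph_auts_def permutes_id)

lemma comp_in_graph_auts:
  assumes "\<sigma> \<in> graph_auts V A" "\<tau> \<in> graph_auts V A"
  shows "\<tau> \<circ> \<sigma> \<in> graph_auts V A"
  using assms by (auto simp: graph_auts_def permutes_compose permutes_in_image)

lemma three_graph_auts:
  assumes "finite V" "\<sigma> \<in> graph_auts V A" "\<tau> \<in> graph_auts V A"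
    and "\<sigma> \<noteq> id" "\<tau> \<noteq> id" "\<sigma> \<noteq> \<tau>"
  shows "3 \<le> card (graph_auts V A)"
proof -
  have "card {id, \<sigma>, \<tau>} \<le> card (graph_auts V A)"
    using assms id_in_graph_auts finite_graph_auts by (intro card_mono) auto
  then show ?thesis using assms by simp
qed

lemma graph_auts_complement:
  assumes irrp: "irreflp A"
  shows "graph_auts V (\<lambda>x y. x \<noteq> y \<and> \<not> A x y) = graph_auts V A"
proof -
  note irr = irreflp_iff[OF irrp]
  have "(\<sigma> x \<noteq> \<sigma> y \<and> \<not> A (\<sigma> x) (\<sigma> y) \<longleftrightarrow> x \<noteq> y \<and> \<not> A x y) \<longleftrightarrow> (A (\<sigma> x) (\<sigma> y) \<longleftrightarrow> A x y)"
    if "\<sigma> permutes V" for \<sigma> x y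
    using irr inj_eq[OF permutes_inj[OF that], of x y] by (cases "x = y") auto
  then show ?thesis unfolding graph_auts_def by (intro Collect_cong conj_cong refl ball_cong) blast
qed

lemma graph_auts_extend:
  assumes s: "\<sigma> \<in> graph_auts C A" and "C \<subseteq> V" and symp: "symp A"
    and join: "\<And>x y. x \<in> C \<Longrightarrow> y \<in> V - C \<Longrightarrow> A (\<sigma> x) y \<longleftrightarrow> A x y"
  shows "\<sigma> \<in> graph_auts V A"
proof -
  note sym = symp_iff[OF symp]
  have p: "\<sigma> permutes C" and a: "\<And>x y. x \<in> C \<Longrightarrow> y \<in> C \<Longrightarrow> A (\<sigma> x) (\<sigma> y) \<longleftrightarrow> A x y"
    using s by (auto simp: graph_auts_def)
  have out: "\<sigma> x = x" if "x \<notin> C" for x using p that by (rule permutes_not_in)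
  have "A (\<sigma> x) (\<sigma> y) \<longleftrightarrow> A x y" if "x \<in> V" "y \<in> V" for x y
  proof -
    consider "x \<in> C" "y \<in> C" | "x \<in> C" "y \<notin> C" | "x \<notin> C" "y \<in> C" | "x \<notin> C" "y \<notin> C" by blast
    then show ?thesis
    proof cases
      case 1
      then show ?thesis by (rule a)
    next
      case 2
      then show ?thesis using join[of x y] that out[of y] by simp
    next
      case 3
      then have "A (\<sigma> y) x \<longleftrightarrow> A y x" using join that by blast
      then show ?thesis using sym[of x "\<sigma> y"] sym[of x y] out[OF 3(1)] by simp
    next
      case 4
      then show ?thesis by (simp add: out)
    qed
  qed
  then show "\<sigma> \<in> graph_auts V A"
    using permutes_subset[OF p \<open>C \<subseteq> V\<close>] by (simp add: graph_auts_def)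
qed

lemma transpose_in_graph_auts:
  assumes "a \<in> C" "b \<in> C" and symp: "symp A" and irrp: "irreflp A"
    and twin: "\<And>y. y \<in> C \<Longrightarrow> y \<noteq> a \<Longrightarrow> y \<noteq> b \<Longrightarrow> A a y \<longleftrightarrow> A b y"
  shows "Transposition.transpose a b \<in> graph_auts C A"
proof -
  note sym = symp_iff[OF symp]
  note irr = irreflp_iff[OF irrp]
  let ?t = "Transposition.transpose a b"
  have out: "A (?t x) y \<longleftrightarrow> A x y" if "x \<in> C" "y \<in> C" "y \<noteq> a" "y \<noteq> b" for x y
    using twin[OF that(2-4)] by (cases "x = a"; cases "x = b") simp_all
  have "A (?t x) (?t y) \<longleftrightarrow> A x y" if "x \<in> C" "y \<in> C" for x y
  proof -
    consider "y \<noteq> a" "y \<noteq> b" | "x \<noteq> a" "x \<noteq> b" | "x \<in> {a, b}" "y \<in> {a, b}" by blast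
    then show ?thesis
    proof cases
      case 1
      then show ?thesis using out[of x y] that by simp
    next
      case 2
      then have "A (?t y) x \<longleftrightarrow> A y x" using out[of y x] that by simp
      then show ?thesis using 2 sym[of "?t y" x] sym[of y x] by simp
    next
      case 3
      then show ?thesis using irr sym[of a b] by auto
    qed
  qed
  then show ?thesis
    using permutes_swap_id[OF assms(1,2)] unfolding graph_auts_def by blast
qed

text \<open>
  A component of a 2-regular graph is a cycle of length at least 3, and rotating one cycle by one and by
  two steps gives two nontrivial automorphisms.  The cycle is found as a path of maximal length: the
  last vertex has no neighbour outside the path, and inner vertices of the path have their two
  neighbours already, so the last vertex is adjacent to the first one.
\<close>

lemma two_regular_graph_auts:
  assumes fin: "finite C" and ne: "C \<noteq> {}"
    and symp: "symp A" and irrp: "irreflp A"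
    and deg: "\<And>x. x \<in> C \<Longrightarrow> card {y\<in>C. A x y} = 2"
  shows "3 \<le> card (graph_auts C A)"
proof -
  note sym = symp_iff[OF symp]
  note irr = irreflp_iff[OF irrp]
  define path where "path xs \<longleftrightarrow> xs \<noteq> [] \<and> distinct xs \<and> set xs \<subseteq> C \<and>
    (\<forall>i. Suc i < length xs \<longrightarrow> A (xs ! i) (xs ! Suc i))" for xs
  obtain x where "x \<in> C" using ne by auto
  then have "path [x]" by (simp add: path_def)
  moreover have "\<forall>xs. path xs \<longrightarrow> length xs < Suc (card C)"
    using fin by (metis path_def card_mono distinct_card le_imp_less_Suc)
  ultimately obtain xs where xs: "path xs" and mx: "\<And>ys. path ys \<Longrightarrow> length ys \<le> length xs"
    using ex_has_greatest_nat[of path "[x]" length "Suc (card C)"] by metis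
  define L where "L = length xs"
  have dist: "distinct xs" and sub: "set xs \<subseteq> C" and "L > 0"
    and adj: "\<And>i. Suc i < L \<Longrightarrow> A (xs ! i) (xs ! Suc i)"
    using xs by (auto simp: path_def L_def)
  have inC: "xs ! i \<in> C" if "i < L" for i using sub that by (auto simp: L_def)
  have inj: "xs ! i = xs ! j \<longleftrightarrow> i = j" if "i < L" "j < L" for i j
    using that dist by (simp add: L_def nth_eq_iff_index_eq)
  have finN: "finite {y\<in>C. A x y}" for x using fin by simp
  have no3: False if "x \<in> C" "{a, b, c} \<subseteq> {y\<in>C. A x y}" "a \<noteq> b" "a \<noteq> c" "b \<noteq> c" for x a b c
    using card_mono[OF finN that(2)] deg[OF that(1)] that by simp
  have last_nbr: "\<exists>i. y = xs ! i \<and> (i = 0 \<or> i + 2 = L) \<and> i < L"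
    if y: "y \<in> C" "A (xs ! (L - 1)) y" for y
  proof -
    have "y \<in> set xs"
    proof (rule ccontr)
      assume "y \<notin> set xs"
      then have "path (xs @ [y])"
        using xs y unfolding path_def
        by (auto simp: nth_append L_def less_Suc_eq) (metis diff_Suc_1 One_nat_def)
      from mx[OF this] show False by simp
    qed
    then obtain i where i: "i < L" "y = xs ! i" by (auto simp: in_set_conv_nth L_def)
    have "i \<noteq> L - 1" using irr y i by auto
    have False if "0 < i" "i + 2 < L"
    proof (rule no3[of y "xs ! (i - 1)" "xs ! (i + 1)" "xs ! (L - 1)"])
      show "{xs ! (i - 1), xs ! (i + 1), xs ! (L - 1)} \<subseteq> {z \<in> C. A y z}"
        using inC that y i adj[of i] adj[of "i - 1"] sym by auto
    qed (use that y inj in auto)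
    then have "\<not> (0 < i \<and> i + 2 < L)" by blast
    with \<open>i \<noteq> L - 1\<close> have "i = 0 \<or> i + 2 = L" using i by linarith
    then show ?thesis using i by auto
  qed
  obtain y z where yz: "y \<noteq> z" "{w\<in>C. A (xs ! (L - 1)) w} = {y, z}"
    using deg[OF inC[of "L - 1"]] \<open>L > 0\<close> by (auto simp: card_2_iff)
  have "y \<in> C" "A (xs ! (L - 1)) y" "z \<in> C" "A (xs ! (L - 1)) z" using yz(2) by blast+
  with last_nbr obtain i j where i: "y = xs ! i" "i = 0 \<or> i + 2 = L" "i < L"
    and j: "z = xs ! j" "j = 0 \<or> j + 2 = L" "j < L" by metis
  have "i \<noteq> j" using i(1) j(1) yz(1) by blast
  then have L3: "L \<ge> 3" and "i = 0 \<or> j = 0" using i j by linarith+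
  then have closed: "A (xs ! (L - 1)) (xs ! 0)"
    using i(1) j(1) \<open>A (xs ! (L - 1)) y\<close> \<open>A (xs ! (L - 1)) z\<close> by blast
  \<comment> \<open>Successor of an index in cyclic order, so that \<open>xs ! i\<close> is rotated to \<open>xs ! nx i\<close>.\<close>
  define nx where "nx i = (if Suc i = L then 0 else Suc i)" for i
  have nx_less: "nx i < L" if "i < L" for i using that by (auto simp: nx_def)
  have nx_inj: "nx i = nx j \<longleftrightarrow> i = j" for i j by (auto simp: nx_def)
  have A_nx: "A (xs ! i) (xs ! nx i)" if "i < L" for i
    using that adj[of i] closed by (auto simp: nx_def)
  have A_iff: "A (xs ! i) (xs ! j) \<longleftrightarrow> j = nx i \<or> i = nx j" if "i < L" "j < L" for i j
  proof
    assume a: "A (xs ! i) (xs ! j)"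
    define k where "k = (if i = 0 then L - 1 else i - 1)"
    have k: "nx k = i" "k < L" "k \<noteq> nx i" using that L3 by (auto simp: nx_def k_def)
    show "j = nx i \<or> i = nx j"
    proof (rule ccontr)
      assume n: "\<not> (j = nx i \<or> i = nx j)"
      show False
      proof (rule no3[of "xs ! i" "xs ! nx i" "xs ! k" "xs ! j"])
        show "{xs ! nx i, xs ! k, xs ! j} \<subseteq> {y \<in> C. A (xs ! i) y}"
          using a that k A_nx[of i] A_nx[of k] sym inC nx_less by auto
      qed (use n k that nx_less inC inj in auto)
    qed
  qed (use A_nx that sym in blast)
  have nbr_in: "y \<in> set xs" if "i < L" "y \<in> C" "A (xs ! i) y" for i y
  proof (rule ccontr)
    assume n: "y \<notin> set xs"
    define k where "k = (if i = 0 then L - 1 else i - 1)"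
    have k: "nx k = i" "k < L" "k \<noteq> nx i" using that L3 by (auto simp: nx_def k_def)
    show False
    proof (rule no3[of "xs ! i" "xs ! nx i" "xs ! k" y])
      show "{xs ! nx i, xs ! k, y} \<subseteq> {y \<in> C. A (xs ! i) y}"
        using that k A_nx[of i] A_nx[of k] sym inC nx_less by auto
    qed (use n k that nx_less inC inj in \<open>auto simp: L_def\<close>)
  qed
  define ix where "ix x = (THE i. i < L \<and> xs ! i = x)" for x
  have ix: "ix (xs ! i) = i" if "i < L" for i
    unfolding ix_def using that inj by (intro the_equality) auto
  define \<sigma> where "\<sigma> x = (if x \<in> set xs then xs ! nx (ix x) else x)" for x
  have s_nth: "\<sigma> (xs ! i) = xs ! nx i" if "i < L" for i
    using that ix by (simp add: \<sigma>_def L_def)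
  have s_out: "\<sigma> x = x" if "x \<notin> set xs" for x using that by (simp add: \<sigma>_def)
  have in_xs: "x \<in> set xs \<longleftrightarrow> (\<exists>i<L. x = xs ! i)" for x by (auto simp: in_set_conv_nth L_def)
  have "inj_on \<sigma> (set xs)"
    by (rule inj_onI) (auto simp: in_xs s_nth inj nx_less nx_inj)
  moreover have "\<sigma> ` set xs \<subseteq> set xs" using nx_less by (force simp: in_xs s_nth)
  ultimately have "bij_betw \<sigma> (set xs) (set xs)"
    by (simp add: bij_betw_def endo_inj_surj)
  then have "\<sigma> permutes set xs" using s_out by (rule bij_imp_permutes)
  then have perm: "\<sigma> permutes C" using sub by (rule permutes_subset)
  have "A (\<sigma> x) (\<sigma> y) \<longleftrightarrow> A x y" if "x \<in> C" "y \<in> C" for x y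
  proof (cases "x \<in> set xs"; cases "y \<in> set xs")
    assume "x \<in> set xs" "y \<in> set xs"
    then obtain i j where "i < L" "x = xs ! i" "j < L" "y = xs ! j" by (auto simp: in_xs)
    then show ?thesis by (simp add: s_nth A_iff nx_less nx_inj)
  next
    assume *: "x \<in> set xs" "y \<notin> set xs"
    then obtain i where "i < L" "x = xs ! i" by (auto simp: in_xs)
    then show ?thesis using * nbr_in that nx_less by (metis s_nth s_out)
  next
    assume *: "x \<notin> set xs" "y \<in> set xs"
    then obtain i where "i < L" "y = xs ! i" by (auto simp: in_xs)
    then show ?thesis using * nbr_in that nx_less sym by (metis s_nth s_out)
  qed (simp add: s_out)
  then have aut: "\<sigma> \<in> graph_auts C A" using perm by (simp add: graph_auts_def)
  have v: "\<sigma> (xs ! 0) = xs ! 1" "\<sigma> (xs ! 1) = xs ! 2"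
    using L3 by (auto simp: s_nth nx_def numeral_eq_Suc)
  have d: "xs ! 0 \<noteq> xs ! 1" "xs ! 0 \<noteq> xs ! 2" "xs ! 1 \<noteq> xs ! 2" using L3 inj by auto
  show ?thesis
  proof (rule three_graph_auts[OF fin aut comp_in_graph_auts[OF aut aut]])
    show "\<sigma> \<noteq> id" using v d by (metis id_apply)
    show "\<sigma> \<circ> \<sigma> \<noteq> id" using v d by (metis id_apply comp_apply)
    show "\<sigma> \<noteq> \<sigma> \<circ> \<sigma>" using v d by (metis comp_apply)
  qed
qed

lemma card_filter_sum: "finite S \<Longrightarrow> card {w\<in>S. P w} = (\<Sum>w\<in>S. of_bool (P w))"
  by (simp add: sum.If_cases of_bool_def Int_def)

lemma transpose_neqI: "\<tau> a \<noteq> b \<Longrightarrow> Transposition.transpose a b \<noteq> \<tau>"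
  by auto

lemma even_sum_degrees:
  fixes C :: "'a::linorder set"
  assumes fin: "finite C" and symp: "symp A" and irrp: "irreflp A"
  shows "even (\<Sum>x\<in>C. card {y\<in>C. A x y})"
proof -
  note sym = symp_iff[OF symp]
  note irr = irreflp_iff[OF irrp]
  define S where "S = {(x, y). x \<in> C \<and> y \<in> C \<and> A x y \<and> x < y}"
  have "S \<subseteq> C \<times> C" by (auto simp: S_def)
  then have finS: "finite S" using fin by (meson finite_SigmaI finite_subset)
  have "(SIGMA x:C. {y\<in>C. A x y}) = S \<union> prod.swap ` S"
  proof (rule Set.set_eqI)
    fix p :: "'a \<times> 'a"
    obtain x y where p: "p = (x, y)" by fastforce
    have "p \<in> prod.swap ` S \<longleftrightarrow> (y, x) \<in> S" unfolding p by force
    then show "p \<in> (SIGMA x:C. {y\<in>C. A x y}) \<longleftrightarrow> p \<in> S \<union> prod.swap ` S"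
      using irr[of x] sym[of x y] unfolding p by (cases x y rule: linorder_cases) (auto simp: S_def)
  qed
  moreover have "S \<inter> prod.swap ` S = {}" by (auto simp: S_def)
  ultimately have "card (SIGMA x:C. {y\<in>C. A x y}) = card S + card S"
    using finS by (simp add: card_Un_disjoint card_image inj_swap)
  then show ?thesis using fin by simp
qed

text \<open>
  Passing to the complement makes the degree at most 2, except for a 3-regular graph on 7 vertices,
  which the parity of the degree sum excludes.  Degrees 0 and 1 admit transpositions of two isolated
  vertices or of the ends of an edge; degree 2 is \<open>two_regular_graph_auts\<close>.
\<close>

lemma regular_graph_auts:
  fixes C :: "'a::linorder set"
  assumes fin: "finite C" and C3: "3 \<le> card C" and C7: "card C \<le> 7"
    and symp: "symp A" and irrp: "irreflp A"
    and deg: "\<And>x. x \<in> C \<Longrightarrow> card {y\<in>C. A x y} = d"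
  shows "3 \<le> card (graph_auts C A)"
proof -
  note sym = symp_iff[OF symp]
  note irr = irreflp_iff[OF irrp]
  have low: "3 \<le> card (graph_auts C B)"
    if sympB: "symp B" and irrpB: "irreflp B" and "e \<le> 2"
      and deg: "\<And>x. x \<in> C \<Longrightarrow> card {y\<in>C. B x y} = e" for B e
  proof -
    obtain T where "T \<subseteq> C" "card T = 3" using obtain_subset_with_card_n[OF C3] by metis
    then obtain a b c where abc: "a \<in> C" "b \<in> C" "c \<in> C" "a \<noteq> b" "a \<noteq> c" "b \<noteq> c"
      by (auto simp: card_3_iff)
    consider "e = 0" | "e = 1" | "e = 2" using \<open>e \<le> 2\<close> by linarith
    then show ?thesis
    proof cases
      case 1
      then have no: "\<not> B x y" if "x \<in> C" "y \<in> C" for x y using deg[OF that(1)] that fin by auto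
      show ?thesis
      proof (rule three_graph_auts[OF fin])
        show "Transposition.transpose a b \<in> graph_auts C B" "Transposition.transpose a c \<in> graph_auts C B"
          using transpose_in_graph_auts[OF _ _ sympB irrpB] abc no by simp_all
        show "Transposition.transpose a b \<noteq> Transposition.transpose a c"
          by (rule transpose_neqI) (use abc in simp)
        show "Transposition.transpose a b \<noteq> id" "Transposition.transpose a c \<noteq> id"
          by (rule transpose_neqI, use abc in simp)+
      qed
    next
      case 2
      have nb: "\<exists>y\<in>C. \<forall>z\<in>C. B x z \<longleftrightarrow> z = y" if x: "x \<in> C" for x
      proof -
        obtain y where "{z\<in>C. B x z} = {y}"
          using deg[OF x] 2 by (metis card_1_singletonE)
        then show ?thesis by blast
      qed
      obtain a' where a': "a' \<in> C" "\<And>z. z \<in> C \<Longrightarrow> B a z \<longleftrightarrow> z = a'" using nb[OF abc(1)] by blast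
      obtain u where u: "u \<in> C" "u \<noteq> a" "u \<noteq> a'" using abc by (cases "a' = b") auto
      obtain u' where u': "u' \<in> C" "\<And>z. z \<in> C \<Longrightarrow> B u z \<longleftrightarrow> z = u'" using nb[OF u(1)] by blast
      have twin: "Transposition.transpose x y \<in> graph_auts C B"
        if xy: "x \<in> C" "y \<in> C" "\<And>z. z \<in> C \<Longrightarrow> B x z \<longleftrightarrow> z = y" for x y
      proof -
        obtain w where w: "\<And>z. z \<in> C \<Longrightarrow> B y z \<longleftrightarrow> z = w" using nb[OF xy(2)] by blast
        have "w = x" using w[OF xy(1)] xy(3)[OF xy(2)] symp_iff[OF sympB, of x y] by simp
        then show ?thesis using transpose_in_graph_auts[OF xy(1,2) sympB irrpB] xy(3) w by simp
      qed
      have ne: "a \<noteq> a'" "u \<noteq> u'"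
        using a'(2)[OF a'(1)] u'(2)[OF u'(1)] irreflp_iff[OF irrpB] by auto
      have "u' \<noteq> a" using u'(2)[OF abc(1)] a'(2)[OF u(1)] u symp_iff[OF sympB, of a u] by auto
      show ?thesis
      proof (rule three_graph_auts[OF fin])
        show "Transposition.transpose a a' \<in> graph_auts C B" "Transposition.transpose u u' \<in> graph_auts C B"
          using twin[OF abc(1) a'] twin[OF u(1) u'] by simp_all
        show "Transposition.transpose a a' \<noteq> Transposition.transpose u u'"
          by (rule transpose_neqI) (use u ne \<open>u' \<noteq> a\<close> in simp)
        show "Transposition.transpose a a' \<noteq> id" "Transposition.transpose u u' \<noteq> id"
          by (rule transpose_neqI, use ne in simp)+
      qed
    next
      case 3
      then have "card {y\<in>C. B x y} = 2" if "x \<in> C" for x using deg[OF that] by simp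
      then show ?thesis using two_regular_graph_auts[OF fin _ sympB irrpB] abc(1) by blast
    qed
  qed
  show ?thesis
  proof (cases "d \<le> 2")
    case True
    then show ?thesis using low[OF symp irrp _ deg] by simp
  next
    case False
    have "even (card C * d)" using even_sum_degrees[OF fin symp irrp] deg by simp
    obtain x where "x \<in> C" using C3 by fastforce
    have cdeg: "card {y\<in>C. x \<noteq> y \<and> \<not> A x y} + Suc d = card C" if "x \<in> C" for x
    proof -
      have "C = {y\<in>C. x \<noteq> y \<and> \<not> A x y} \<union> ({y\<in>C. A x y} \<union> {x})" using that by auto
      then have "card C = card {y\<in>C. x \<noteq> y \<and> \<not> A x y} + card ({y\<in>C. A x y} \<union> {x})"
        using fin irr by (subst card_Un_disjoint[symmetric]) auto
      then show ?thesis using deg[OF that] fin irr by simp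
    qed
    from cdeg[OF \<open>x \<in> C\<close>] have le: "Suc d \<le> card C" by linarith
    have "card C - Suc d \<le> 2"
    proof (rule ccontr)
      assume "\<not> card C - Suc d \<le> 2"
      then have "card C = 7" "d = 3" using False C7 by linarith+
      then show False using \<open>even (card C * d)\<close> by simp
    qed
    moreover have "card {y\<in>C. x \<noteq> y \<and> \<not> A x y} = card C - Suc d" if "x \<in> C" for x
      using cdeg[OF that] by linarith
    moreover have "symp (\<lambda>x y. x \<noteq> y \<and> \<not> A x y)" "irreflp (\<lambda>x y. x \<noteq> y \<and> \<not> A x y)"
      using sym by (auto simp: symp_def irreflp_def)
    ultimately have "3 \<le> card (graph_auts C (\<lambda>x y. x \<noteq> y \<and> \<not> A x y))"
      by (intro low) simp_all
    then show ?thesis using graph_auts_complement[OF irrp, of C] by simp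
  qed
qed

section \<open>Equitable partitions of graphs with at most seven vertices\<close>

lemma sum_nbrs_commute:
  assumes "finite C" "finite D" and symp: "symp A"
  shows "(\<Sum>x\<in>C. card {y\<in>D. A x y}) = (\<Sum>y\<in>D. card {x\<in>C. A y x})"
  unfolding card_filter_sum[OF assms(1)] card_filter_sum[OF assms(2)]
  by (subst sum.swap) (intro sum.cong refl arg_cong[of _ _ of_bool] symp_iff[OF symp])

lemma double_transpose_in_graph_auts:
  assumes V: "a \<in> V" "b \<in> V" "a' \<in> V" "b' \<in> V"
    and dist: "a \<noteq> b" "a' \<noteq> b'" "a \<noteq> a'" "a \<noteq> b'" "b \<noteq> a'" "b \<noteq> b'"
    and symp: "symp A" and irrp: "irreflp A"
    and inner: "A a a' \<longleftrightarrow> A b b'" "A a b' \<longleftrightarrow> A b a'"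
    and outer: "\<And>z. z \<in> V \<Longrightarrow> z \<notin> {a, b, a', b'} \<Longrightarrow> (A a z \<longleftrightarrow> A b z) \<and> (A a' z \<longleftrightarrow> A b' z)"
  shows "Transposition.transpose a b \<circ> Transposition.transpose a' b' \<in> graph_auts V A"
proof -
  note sym = symp_iff[OF symp]
  note irr = irreflp_iff[OF irrp]
  define s where "s = Transposition.transpose a b \<circ> Transposition.transpose a' b'"
  have perm: "s permutes V" unfolding s_def using V by (intro permutes_compose permutes_swap_id)
  have val: "s a = b" "s b = a" "s a' = b'" "s b' = a'"
    "\<And>z. z \<notin> {a, b, a', b'} \<Longrightarrow> s z = z"
    using dist by (auto simp: s_def Transposition.transpose_def)
  have tab: "A b a = A a b" "A b' a' = A a' b'" "A b b' = A a a'" "A b' b = A a a'" "A a' a = A a a'"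
    "A b a' = A a b'" "A a' b = A a b'" "A b' a = A a b'"
    using inner sym by blast+
  have out: "A b z = A a z" "A b' z = A a' z" "A z a = A a z" "A z b = A a z" "A z a' = A a' z" "A z b' = A a' z"
    if "z \<in> V" "z \<notin> {a, b, a', b'}" for z
    using outer[OF that] sym by blast+
  have "A (s x) (s y) = A x y" if "x \<in> V" "y \<in> V" for x y
  proof -
    have "x \<in> {a, b, a', b'} \<or> x \<notin> {a, b, a', b'}" "y \<in> {a, b, a', b'} \<or> y \<notin> {a, b, a', b'}" by blast+
    then show ?thesis
      using that by (elim disjE insertE emptyE) (simp_all only: val tab out irr simp_thms)
  qed
  then show ?thesis using perm unfolding graph_auts_def s_def by blast
qed

text \<open>
  The four vertices \<open>a, b, c, d\<close> are split into \<open>{a, b}\<close> and \<open>{c, d}\<close> according to their neighbour in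
  \<open>{p, q}\<close>; exchanging the halves is compensated by exchanging \<open>p\<close> and \<open>q\<close>.
\<close>

lemma split_four_in_graph_auts:
  assumes V: "{a, b, c, d, p, q} \<subseteq> V"
    and dist: "distinct [a, b, c, d, p, q]"
    and symp: "symp A" and irrp: "irreflp A"
    and inner: "A a b \<longleftrightarrow> A c d" "A a d \<longleftrightarrow> A b c"
    and cross: "A p a" "A p b" "\<not> A p c" "\<not> A p d" "\<not> A q a" "\<not> A q b" "A q c" "A q d"
    and outer: "\<And>z. z \<in> V \<Longrightarrow> z \<notin> {a, b, c, d, p, q} \<Longrightarrow>
      (A a z \<longleftrightarrow> A c z) \<and> (A b z \<longleftrightarrow> A d z) \<and> (A p z \<longleftrightarrow> A q z)"
  shows "Transposition.transpose a c \<circ> (Transposition.transpose b d \<circ> Transposition.transpose p q) \<in> graph_auts V A"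
proof -
  note sym = symp_iff[OF symp]
  note irr = irreflp_iff[OF irrp]
  define s where "s = Transposition.transpose a c \<circ> (Transposition.transpose b d \<circ> Transposition.transpose p q)"
  have perm: "s permutes V" unfolding s_def using V by (intro permutes_compose permutes_swap_id) auto
  have val: "s a = c" "s b = d" "s c = a" "s d = b" "s p = q" "s q = p"
    "\<And>z. z \<notin> {a, b, c, d, p, q} \<Longrightarrow> s z = z"
    using dist by (auto simp: s_def Transposition.transpose_def)
  have tab: "A b a = A a b" "A c d = A a b" "A d c = A a b"
    "A b c = A a d" "A c b = A a d" "A d a = A a d"
    "A c a = A a c" "A d b = A b d" "A q p = A p q"
    using inner sym by blast+
  have cross': "A a p" "A b p" "\<not> A c p" "\<not> A d p" "\<not> A a q" "\<not> A b q" "A c q" "A d q"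
    using cross sym by blast+
  have out: "A c z = A a z" "A d z = A b z" "A q z = A p z" "A z a = A a z" "A z b = A b z"
    "A z c = A a z" "A z d = A b z" "A z p = A p z" "A z q = A p z"
    if "z \<in> V" "z \<notin> {a, b, c, d, p, q}" for z
    using outer[OF that] sym by blast+
  have "A (s x) (s y) = A x y" if "x \<in> V" "y \<in> V" for x y
  proof -
    have "x \<in> {a, b, c, d, p, q} \<or> x \<notin> {a, b, c, d, p, q}"
      "y \<in> {a, b, c, d, p, q} \<or> y \<notin> {a, b, c, d, p, q}" by blast+
    then show ?thesis
      using that by (elim disjE insertE emptyE) (simp_all only: val tab cross cross' out irr simp_thms)
  qed
  then show ?thesis using perm unfolding graph_auts_def s_def by blast
qed

text \<open>
  A subset of size 1 or 2 of a three-element set is a point or the complement of a point.  This treats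
  a perfect matching between two triples and its complement at the same time.
\<close>

lemma exceptional_point:
  assumes "card S = 3" and "card {y\<in>S. P y} = d" and "d = 1 \<or> d = 2"
  shows "\<exists>b\<in>S. \<forall>y\<in>S. P y \<longleftrightarrow> (y = b \<longleftrightarrow> d = 1)"
proof -
  have fin: "finite S" using assms(1) card.infinite by fastforce
  have "card {y\<in>S. P y \<longleftrightarrow> d = 1} = 1"
  proof (cases "d = 1")
    case False
    have "card (S - {y\<in>S. P y}) = 1" using assms False fin by (subst card_Diff_subset) auto
    moreover have "S - {y\<in>S. P y} = {y\<in>S. P y \<longleftrightarrow> d = 1}" using False by auto
    ultimately show ?thesis by simp
  qed (use assms in simp)
  then obtain b where b: "{y\<in>S. P y \<longleftrightarrow> d = 1} = {b}" by (auto simp: card_1_singleton_iff)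
  then show ?thesis by (intro bexI[of _ b]) blast+
qed

text \<open>
  Let \<open>C\<close> be a cell with \<open>k \<ge> 3\<close> vertices.  If some vertex outside is joined to a proper nonempty part
  of \<open>C\<close>, and \<open>D\<close> is its cell, then counting the edges between \<open>C\<close> and \<open>D\<close> gives \<open>k * d = card D * e\<close>
  with \<open>0 < e < k\<close>, which together with \<open>k + card D \<le> 7\<close> leaves only the sizes \<open>(3, 3)\<close> and \<open>(4, 2)\<close>.
\<close>

lemma equitable_cell_card_le_2:
  fixes V :: "'a::linorder set" and col :: "'a \<Rightarrow> 'c"
  assumes fin: "finite V" and V7: "card V \<le> 7"
    and symp: "symp A" and irrp: "irreflp A"
    and equitable: "\<And>x y z. x \<in> V \<Longrightarrow> y \<in> V \<Longrightarrow> z \<in> V \<Longrightarrow> col x = col y \<Longrightarrow>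
      card {w \<in> {w\<in>V. col w = col z}. A x w} = card {w \<in> {w\<in>V. col w = col z}. A y w}"
    and few: "card (graph_auts V A) < 3" and x0: "x0 \<in> V"
  shows "card {w\<in>V. col w = col x0} \<le> 2"
proof (rule ccontr)
  note sym = symp_iff[OF symp]
  note irr = irreflp_iff[OF irrp]
  define cell where "cell z = {w\<in>V. col w = col z}" for z
  have cellV: "cell z \<subseteq> V" for z by (auto simp: cell_def)
  have fincell: "finite (cell z)" for z using fin cellV finite_subset by blast
  have self: "z \<in> cell z" if "z \<in> V" for z using that by (simp add: cell_def)
  have eq: "card {w\<in>cell z. A x w} = card {w\<in>cell z. A y w}"
    if "x \<in> V" "y \<in> cell x" "z \<in> V" for x y z
    using equitable[of x y z] that by (simp add: cell_def)
  assume large: "\<not> card {w\<in>V. col w = col x0} \<le> 2"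
  define C where "C = cell x0"
  have C3: "3 \<le> card C" using large by (simp add: C_def cell_def)
  have finC: "finite C" and CV: "C \<subseteq> V" using fincell cellV by (auto simp: C_def)
  have C7: "card C \<le> 7" using card_mono[OF fin CV] V7 by linarith
  have degC: "card {w\<in>C. A c w} = card {w\<in>C. A x0 w}" if "c \<in> C" for c
    using eq[of x0 c x0] x0 that by (simp add: C_def)
  have "\<exists>y\<in>V - C. \<exists>c\<in>C. \<exists>c'\<in>C. A y c \<and> \<not> A y c'"
  proof (rule ccontr)
    assume "\<not> ?thesis"
    then have triv: "A c y \<longleftrightarrow> A c' y" if "c \<in> C" "c' \<in> C" "y \<in> V - C" for c c' y
      using that sym by metis
    have "graph_auts C A \<subseteq> graph_auts V A"
    proof
      fix \<sigma> assume s: "\<sigma> \<in> graph_auts C A"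
      then have "\<sigma> c \<in> C" if "c \<in> C" for c
        using that permutes_in_image by (fastforce simp: graph_auts_def)
      then show "\<sigma> \<in> graph_auts V A"
        using triv by (intro graph_auts_extend[OF s CV symp]) blast
    qed
    then have "card (graph_auts C A) \<le> card (graph_auts V A)"
      by (rule card_mono[OF finite_graph_auts[OF fin]])
    then show False
      using regular_graph_auts[OF finC C3 C7 symp irrp degC] few by linarith
  qed
  then obtain y0 c1 c2 where y0: "y0 \<in> V" "y0 \<notin> C" and c12: "c1 \<in> C" "c2 \<in> C" "A y0 c1" "\<not> A y0 c2"
    by blast
  define D where "D = cell y0"
  have finD: "finite D" and DV: "D \<subseteq> V" and y0D: "y0 \<in> D"
    using fincell cellV self y0 by (auto simp: D_def)
  have CD: "C \<inter> D = {}" using y0 by (auto simp: C_def D_def cell_def)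
  define e where "e = card {c\<in>C. A y0 c}"
  define d where "d = card {y\<in>D. A x0 y}"
  have e: "card {c\<in>C. A y c} = e" if "y \<in> D" for y
    using eq[of y0 y x0] y0 that x0 by (simp add: e_def C_def D_def)
  have d: "card {y\<in>D. A c y} = d" if "c \<in> C" for c
    using eq[of x0 c y0] y0 that x0 by (simp add: d_def C_def D_def)
  have de: "card C * d = card D * e"
    using sum_nbrs_commute[OF finC finD symp] d e by simp
  have "0 < e" using c12 finC by (auto simp: e_def card_gt_0_iff)
  have "{c\<in>C. A y0 c} \<subset> C" using c12 by blast
  then have "e < card C" using finC by (simp add: e_def psubset_card_mono)
  have "d \<le> card D" using finD by (simp add: d_def card_mono)
  have "card C + card D \<le> 7"
    using card_mono[OF fin, of "C \<union> D"] CV DV V7 finC finD CD by (simp add: card_Un_disjoint)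
  \<comment> \<open>The edge count decides everything: \<open>k\<close> must share a factor with \<open>card D\<close>.\<close>
  have sizes: "card C = 3 \<and> card D = 3 \<and> e = d \<and> (d = 1 \<or> d = 2) \<or> card C = 4 \<and> card D = 2 \<and> d = 1 \<and> e = 2"
  proof -
    have "0 < card D" using y0D finD by (auto simp: card_gt_0_iff)
    then have "card C = 3 \<or> card C = 4 \<or> card C = 5 \<or> card C = 6"
      "card D = 1 \<or> card D = 2 \<or> card D = 3 \<or> card D = 4"
      using C3 \<open>card C + card D \<le> 7\<close> by linarith+
    then show ?thesis
      using de \<open>0 < e\<close> \<open>e < card C\<close> \<open>d \<le> card D\<close> \<open>card C + card D \<le> 7\<close>
      by (elim disjE; simp; presburger)
  qed
  \<comment> \<open>At least six of the at most seven vertices lie in the two cells, so any other cell is a singleton.\<close>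
  have rest: "A x w \<longleftrightarrow> A y w" if "x \<in> V" "y \<in> cell x" "w \<in> V - (C \<union> D)" for x y w
  proof -
    have "cell w \<subseteq> V - (C \<union> D)"
      using that by (auto simp: cell_def C_def D_def)
    moreover have "card (V - (C \<union> D)) \<le> 1"
      using card_Diff_subset[of "C \<union> D" V] card_Un_disjoint[OF finC finD CD] finC finD CV DV V7 sizes
      by auto
    ultimately have "card (cell w) \<le> 1" using card_mono[of "V - (C \<union> D)" "cell w"] fin by simp
    then have "cell w = {w}"
      using self[of w] that(3) fincell[of w] card_le_Suc0_iff_eq[OF fincell] by auto
    then have c: "{v\<in>cell w. A u v} = (if A u w then {w} else {})" for u by auto
    show ?thesis using eq[of x y w] that unfolding c by (auto split: if_splits)
  qed
  consider (three) "card C = 3" "card D = 3" "e = d" "d = 1 \<or> d = 2"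
    | (four) "card C = 4" "card D = 2" "d = 1" "e = 2"
    using sizes by blast
  then show False
  proof cases
    case three
    have exC: "\<exists>b\<in>D. \<forall>y\<in>D. A x y \<longleftrightarrow> (y = b \<longleftrightarrow> d = 1)" if "x \<in> C" for x
      using exceptional_point[OF three(2) d[OF that] three(4)] .
    have exD: "\<exists>b\<in>C. \<forall>x\<in>C. A y x \<longleftrightarrow> (x = b \<longleftrightarrow> d = 1)" if "y \<in> D" for y
      using exceptional_point[OF three(1) e[OF that]] three(3,4) by blast
    obtain a b c where C: "C = {a, b, c}" "a \<noteq> b" "b \<noteq> c" "a \<noteq> c"
      using three(1) by (auto simp: card_3_iff)
    obtain a' where a': "a' \<in> D" "\<And>y. y \<in> D \<Longrightarrow> A a y \<longleftrightarrow> (y = a' \<longleftrightarrow> d = 1)" using exC[of a] C by blast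
    obtain b' where b': "b' \<in> D" "\<And>y. y \<in> D \<Longrightarrow> A b y \<longleftrightarrow> (y = b' \<longleftrightarrow> d = 1)" using exC[of b] C by blast
    obtain c' where c': "c' \<in> D" "\<And>y. y \<in> D \<Longrightarrow> A c y \<longleftrightarrow> (y = c' \<longleftrightarrow> d = 1)" using exC[of c] C by blast
    have uniq: "x = y" if "x \<in> C" "y \<in> C" "z \<in> D" "A x z \<longleftrightarrow> d = 1" "A y z \<longleftrightarrow> d = 1" for x y z
      using exD[OF that(3)] that sym by metis
    have ne: "a' \<noteq> b'" "b' \<noteq> c'" "a' \<noteq> c'"
      using uniq[of a b a'] uniq[of b c b'] uniq[of a c a'] a' b' c' C by auto
    have "{a', b', c'} \<subseteq> D" "card {a', b', c'} = card D" using a' b' c' ne three(2) by auto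
    then have D: "D = {a', b', c'}" using finD by (metis card_subset_eq)
    have inner: "A x y \<longleftrightarrow> A x z" "A x y \<longleftrightarrow> A y z"
      if S: "S = {x, y, z}" and "x \<noteq> y" "y \<noteq> z" "x \<noteq> z"
        and deg: "\<And>u. u \<in> S \<Longrightarrow> card {w\<in>S. A u w} = k" for S k x y z
    proof -
      have deg': "(\<Sum>w\<in>{x, y, z}. of_bool (A u w)) = k" if "u \<in> {x, y, z}" for u
        using deg[of u] that card_filter_sum[of S "A u"] S by simp
      have "of_bool (A x y) + of_bool (A x z) = k" "of_bool (A x y) + of_bool (A y z) = k"
        "of_bool (A x z) + of_bool (A y z) = k"
        using deg'[of x] deg'[of y] deg'[of z] \<open>x \<noteq> y\<close> \<open>y \<noteq> z\<close> \<open>x \<noteq> z\<close> irr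
          sym[of y x] sym[of z x] sym[of z y]
        by (simp_all del: sum_of_bool_eq)
      then show "A x y \<longleftrightarrow> A x z" "A x y \<longleftrightarrow> A y z" by (auto simp: of_bool_def split: if_splits)
    qed
    have degD: "card {w\<in>D. A y w} = card {w\<in>D. A y0 w}" if "y \<in> D" for y
      using eq[of y0 y y0] y0 that by (simp add: D_def)
    note iC = inner[OF C degC] and iD = inner[OF D ne degD]
    have cross: "A a a' \<longleftrightarrow> d = 1" "A a b' \<longleftrightarrow> d \<noteq> 1" "A a c' \<longleftrightarrow> d \<noteq> 1"
      "A b a' \<longleftrightarrow> d \<noteq> 1" "A b b' \<longleftrightarrow> d = 1" "A b c' \<longleftrightarrow> d \<noteq> 1"
      "A c a' \<longleftrightarrow> d \<noteq> 1" "A c b' \<longleftrightarrow> d \<noteq> 1" "A c c' \<longleftrightarrow> d = 1"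
      using a' b' c' ne by auto
    have outer: "A u z \<longleftrightarrow> A v z" if "z \<in> V" "z \<notin> C" "z \<notin> D" "u \<in> C \<and> v \<in> C \<or> u \<in> D \<and> v \<in> D" for u v z
    proof (rule rest)
      show "u \<in> V" "z \<in> V - (C \<union> D)" using that CV DV by auto
      show "v \<in> cell u" using that(4) by (auto simp: C_def D_def cell_def)
    qed
    have inV: "a \<in> V" "b \<in> V" "c \<in> V" "a' \<in> V" "b' \<in> V" "c' \<in> V"
      using CV DV unfolding C(1) D by simp_all
    let ?s = "Transposition.transpose a b \<circ> Transposition.transpose a' b'"
    let ?t = "Transposition.transpose a c \<circ> Transposition.transpose a' c'"
    have dist: "distinct [a, b, c, a', b', c']" using C(2-4) ne CD unfolding C(1) D by auto
    have "(A a z \<longleftrightarrow> A b z) \<and> (A a' z \<longleftrightarrow> A b' z)" if z: "z \<in> V" "z \<notin> {a, b, a', b'}" for z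
    proof -
      have "z = c \<or> z = c' \<or> z \<notin> C \<and> z \<notin> D" using z(2) unfolding C(1) D by simp blast
      then show ?thesis
      proof (elim disjE conjE)
        assume "z = c"
        then show ?thesis using iC cross sym[of a' c] sym[of b' c] by blast
      next
        assume "z = c'"
        then show ?thesis using iD cross by blast
      next
        assume "z \<notin> C" "z \<notin> D"
        then show ?thesis using outer[of z a b] outer[of z a' b'] z(1) unfolding C(1) D by blast
      qed
    qed
    then have s: "?s \<in> graph_auts V A"
      using dist cross
      by (intro double_transpose_in_graph_auts[OF inV(1,2,4,5) _ _ _ _ _ _ symp irrp]) auto
    have "(A a z \<longleftrightarrow> A c z) \<and> (A a' z \<longleftrightarrow> A c' z)" if z: "z \<in> V" "z \<notin> {a, c, a', c'}" for z
    proof -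
      have "z = b \<or> z = b' \<or> z \<notin> C \<and> z \<notin> D" using z(2) unfolding C(1) D by simp blast
      then show ?thesis
      proof (elim disjE conjE)
        assume "z = b"
        then show ?thesis using iC cross sym[of c b] sym[of a' b] sym[of c' b] by blast
      next
        assume "z = b'"
        then show ?thesis using iD cross sym[of c' b'] by blast
      next
        assume "z \<notin> C" "z \<notin> D"
        then show ?thesis using outer[of z a c] outer[of z a' c'] z(1) unfolding C(1) D by blast
      qed
    qed
    then have t: "?t \<in> graph_auts V A"
      using dist cross
      by (intro double_transpose_in_graph_auts[OF inV(1,3,4,6) _ _ _ _ _ _ symp irrp]) auto
    have ab: "?s a = b" "?t a = c" using dist by (simp_all add: Transposition.transpose_def)
    have "?s \<noteq> id" "?t \<noteq> id" "?s \<noteq> ?t" using ab dist by (metis distinct_length_2_or_more id_apply)+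
    then show False using three_graph_auts[OF fin s t] few by linarith
  next
    case four
    obtain p q where D: "D = {p, q}" "p \<noteq> q" using four(2) by (auto simp: card_2_iff)
    have "card {w\<in>C. A p w} = 2" using e[of p] D four by auto
    then obtain a b where ab: "{w\<in>C. A p w} = {a, b}" "a \<noteq> b" by (auto simp: card_2_iff)
    have "card (C - {a, b}) = 2" using ab four finC by (subst card_Diff_subset) auto
    then obtain c d' where cd: "C - {a, b} = {c, d'}" "c \<noteq> d'" by (auto simp: card_2_iff)
    have C: "C = {a, b, c, d'}" using ab cd by blast
    have other: "A x q \<longleftrightarrow> \<not> A x p" if "x \<in> C" for x
    proof -
      have "of_bool (A x p) + of_bool (A x q) = (1::nat)"
        using d[OF that] four(3) card_filter_sum[OF finD, of "A x"] D(2)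
        by (simp add: D(1) del: sum_of_bool_eq)
      then show ?thesis by (auto simp: of_bool_def split: if_splits)
    qed
    have cross: "A p a" "A p b" "\<not> A p c" "\<not> A p d'" using ab cd by blast+
    have cross': "\<not> A q a" "\<not> A q b" "A q c" "A q d'"
      using other[of a] other[of b] other[of c] other[of d'] cross sym C by blast+
    have dist: "distinct [a, b, c, d', p, q]" using ab(2) cd D(2) CD unfolding C D(1) by auto
    have inV: "{a, b, c, d', p, q} \<subseteq> V" using CV DV unfolding C D(1) by simp
    \<comment> \<open>Equal degrees on four vertices make each of the three perfect matchings of \<open>C\<close> monochromatic.\<close>
    have inner: "A a b \<longleftrightarrow> A c d'" "A a c \<longleftrightarrow> A b d'" "A a d' \<longleftrightarrow> A b c"
    proof -
      define k where "k = card {w\<in>C. A x0 w}"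
      have deg': "(\<Sum>w\<in>{a, b, c, d'}. of_bool (A u w)) = k" if "u \<in> {a, b, c, d'}" for u
        using degC[of u] that card_filter_sum[OF finC, of "A u"] C by (simp add: k_def)
      have "of_bool (A a b) + of_bool (A a c) + of_bool (A a d') = k"
        "of_bool (A a b) + of_bool (A b c) + of_bool (A b d') = k"
        "of_bool (A a c) + of_bool (A b c) + of_bool (A c d') = k"
        "of_bool (A a d') + of_bool (A b d') + of_bool (A c d') = k"
        using deg'[of a] deg'[of b] deg'[of c] deg'[of d'] dist irr
          sym[of b a] sym[of c a] sym[of d' a] sym[of c b] sym[of d' b] sym[of d' c]
        by (simp_all del: sum_of_bool_eq)
      then show "A a b \<longleftrightarrow> A c d'" "A a c \<longleftrightarrow> A b d'" "A a d' \<longleftrightarrow> A b c"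
        by (auto simp: of_bool_def split: if_splits)
    qed
    have outer: "A u z \<longleftrightarrow> A v z" if "z \<in> V" "z \<notin> C" "z \<notin> D" "u \<in> C \<and> v \<in> C \<or> u \<in> D \<and> v \<in> D" for u v z
    proof (rule rest)
      show "u \<in> V" "z \<in> V - (C \<union> D)" using that CV DV by auto
      show "v \<in> cell u" using that(4) by (auto simp: C_def D_def cell_def)
    qed
    let ?s = "Transposition.transpose a b \<circ> Transposition.transpose c d'"
    let ?t = "Transposition.transpose a c \<circ> (Transposition.transpose b d' \<circ> Transposition.transpose p q)"
    have "(A a z \<longleftrightarrow> A b z) \<and> (A c z \<longleftrightarrow> A d' z)" if z: "z \<in> V" "z \<notin> {a, b, c, d'}" for z
    proof -
      have "z = p \<or> z = q \<or> z \<notin> C \<and> z \<notin> D" using z(2) unfolding C D(1) by simp blast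
      then show ?thesis
      proof (elim disjE conjE)
        assume "z = p" then show ?thesis using cross sym[of p] by blast
      next
        assume "z = q" then show ?thesis using cross' sym[of q] by blast
      next
        assume "z \<notin> C" "z \<notin> D"
        then show ?thesis using outer[of z a b] outer[of z c d'] z(1) unfolding C by blast
      qed
    qed
    then have s: "?s \<in> graph_auts V A"
      using dist inner inV
      by (intro double_transpose_in_graph_auts[OF _ _ _ _ _ _ _ _ _ _ symp irrp]) auto
    have "(A a z \<longleftrightarrow> A c z) \<and> (A b z \<longleftrightarrow> A d' z) \<and> (A p z \<longleftrightarrow> A q z)"
      if z: "z \<in> V" "z \<notin> {a, b, c, d', p, q}" for z
      using outer[of z a c] outer[of z b d'] outer[of z p q] z unfolding C D(1) by simp
    then have t: "?t \<in> graph_auts V A"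
      by (rule split_four_in_graph_auts[OF inV dist symp irrp inner(1,3) cross cross'])
    have ab: "?s a = b" "?t a = c" using dist by (simp_all add: Transposition.transpose_def)
    have "?s \<noteq> id" "?t \<noteq> id" "?s \<noteq> ?t" using ab dist by (metis distinct_length_2_or_more id_apply)+
    then show False using three_graph_auts[OF fin s t] few by linarith
  qed
qed

section \<open>The free star-algebra and its characters\<close>

abbreviation lookup where "lookup \<equiv> Poly_Mapping.lookup"
abbreviation single where "single \<equiv> Poly_Mapping.single"

lemma single_mult: "single v a * single w b = single (v @ w) (a * b)"
  by (simp add: mult_single plus_list_def)

lemma one_single: "1 = single [] (1 :: 'a :: zero_neq_one)"
  by (metis single_one zero_list_def)

lemma star_poly_expansion: "a = (\<Sum>w\<in>Poly_Mapping.keys a. single w (lookup a w))"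
proof (rule poly_mapping_eqI)
  fix v
  have "(\<Sum>w\<in>Poly_Mapping.keys a. lookup (single w (lookup a w)) v) =
    (\<Sum>w\<in>Poly_Mapping.keys a. if w = v then lookup a v else 0)"
    by (intro sum.cong) (auto simp: lookup_single when_def)
  also have "\<dots> = lookup a v"
    by (simp add: in_keys_iff)
  finally show "lookup a v = lookup (\<Sum>w\<in>Poly_Mapping.keys a. single w (lookup a w)) v"
    by (simp add: lookup_sum)
qed

text \<open>
  Every star-polynomial is a sum of multiples of words, so additive statements need only be checked on
  single words.
\<close>

lemma free_star_induct [consumes 1, case_names single add]:
  assumes a: "a \<in> free_star_carrier X"
    and s: "\<And>w c. (\<And>l. l \<in> set w \<Longrightarrow> gen_of l \<in> X) \<Longrightarrow> P (single w c)"
    and add: "\<And>b c. P b \<Longrightarrow> P c \<Longrightarrow> P (b + c)"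
  shows "P a"
proof -
  have "P (\<Sum>w\<in>S. single w (lookup a w))" if "S \<subseteq> Poly_Mapping.keys a" "finite S" for S
    using that(2,1)
  proof induction
    case empty
    show ?case using s[of "[]" 0] by simp
  next
    case (insert w S)
    then show ?case using a s[of w] add by (auto simp: free_star_carrier_def)
  qed
  from this[OF order_refl] show ?thesis using star_poly_expansion[of a] by simp
qed

lemma in_free_star_UNIV: "a \<in> free_star_carrier UNIV"
  by (simp add: free_star_carrier_def)

lemmas star_poly_induct = free_star_induct[OF in_free_star_UNIV, case_names single add]

lemma single_in_free_star: "(\<And>l. l \<in> set w \<Longrightarrow> gen_of l \<in> X) \<Longrightarrow> single w c \<in> free_star_carrier X"
  by (auto simp: free_star_carrier_def split: if_splits)

lemma free_star_add [simp]:
  "a \<in> free_star_carrier X \<Longrightarrow> b \<in> free_star_carrier X \<Longrightarrow> a + b \<in> free_star_carrier X"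
  using keys_add[of a b] by (auto simp: free_star_carrier_def)

lemma free_star_mult [simp]:
  assumes "a \<in> free_star_carrier X" "b \<in> free_star_carrier X"
  shows "a * b \<in> free_star_carrier X"
  using keys_mult[of a b] assms by (fastforce simp: free_star_carrier_def plus_list_def)

lemma free_star_const [simp]: "const_poly c \<in> free_star_carrier X"
  by (auto simp: const_poly_def intro!: single_in_free_star)

lemma free_star_zero [simp]: "0 \<in> free_star_carrier X"
  by (simp add: free_star_carrier_def)

lemma free_star_one [simp]: "1 \<in> free_star_carrier X"
  by (auto simp: one_single intro!: single_in_free_star)

lemma free_star_gen [simp]: "x \<in> X \<Longrightarrow> gen_poly x \<in> free_star_carrier X"
  by (auto simp: gen_poly_def intro!: single_in_free_star)

lemma const_poly_0 [simp]: "const_poly 0 = 0"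
  and const_poly_1 [simp]: "const_poly 1 = 1"
  and const_poly_add: "const_poly (a + b) = const_poly a + const_poly b"
  and const_poly_mult: "const_poly (a * b) = const_poly a * const_poly b"
  and const_poly_minus: "const_poly (- a) = - const_poly a"
  by (simp_all add: const_poly_def single_mult single_add single_uminus one_single)

lemma const_poly_diff: "const_poly (a - b) = const_poly a - const_poly b"
  using const_poly_add[of a "- b"] by (simp add: const_poly_minus)

lemma const_poly_commute: "a * const_poly c = const_poly c * a"
  by (induction a rule: star_poly_induct)
     (simp_all add: const_poly_def single_mult mult.commute distrib_left distrib_right)

lemma const_poly_left_commute: "a * (const_poly c * b) = const_poly c * (a * b)"
  by (metis const_poly_commute mult.assoc)

lemma const_poly_assoc: "const_poly c * (const_poly d * a) = const_poly (c * d) * a"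
  by (simp add: const_poly_mult mult.assoc)

lemma free_star_uminus [simp]: "a \<in> free_star_carrier X \<Longrightarrow> - a \<in> free_star_carrier X"
  by (simp add: free_star_carrier_def)

lemma free_star_diff [simp]:
  "a \<in> free_star_carrier X \<Longrightarrow> b \<in> free_star_carrier X \<Longrightarrow> a - b \<in> free_star_carrier X"
  using free_star_add[of a X "- b"] by simp

lemma free_star_sum [simp]:
  "(\<And>i. i \<in> I \<Longrightarrow> f i \<in> free_star_carrier X) \<Longrightarrow> sum f I \<in> free_star_carrier X"
  by (induction I rule: infinite_finite_induct) auto

lemma poly_star_superset:
  assumes "finite S" "Poly_Mapping.keys a \<subseteq> S"
  shows "poly_star a = (\<Sum>w\<in>S. single (rev (map letter_star w)) (cnj (lookup a w)))"
  unfolding poly_star_def using assms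
  by (intro sum.mono_neutral_left) (auto simp: in_keys_iff)

lemma poly_star_single [simp]: "poly_star (single w c) = single (rev (map letter_star w)) (cnj c)"
  by (subst poly_star_superset[of "{w}"]) auto

lemma poly_star_add [simp]: "poly_star (a + b) = poly_star a + poly_star b"
proof -
  let ?S = "Poly_Mapping.keys a \<union> Poly_Mapping.keys b"
  show ?thesis
    using keys_add[of a b]
    by (simp add: poly_star_superset[of ?S a] poly_star_superset[of ?S b] poly_star_superset[of ?S "a + b"]
        lookup_add single_add sum.distrib)
qed

lemma poly_star_mult [simp]: "poly_star (a * b) = poly_star b * poly_star a"
proof (induction a rule: star_poly_induct)
  case (single w c)
  show ?case
    by (induction b rule: star_poly_induct) (simp_all add: single_mult mult.commute distrib_left distrib_right)
qed (simp add: distrib_left distrib_right)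

lemma poly_star_const [simp]: "poly_star (const_poly c) = const_poly (cnj c)"
  by (simp add: const_poly_def)

lemma poly_star_0 [simp]: "poly_star 0 = 0"
  by (simp add: poly_star_def)

lemma poly_star_1 [simp]: "poly_star 1 = 1"
  by (simp add: one_single)

lemma poly_star_uminus [simp]: "poly_star (- a) = - poly_star a"
  using poly_star_add[of a "- a"] by (simp add: eq_neg_iff_add_eq_0 add.commute)

lemma poly_star_diff [simp]: "poly_star (a - b) = poly_star a - poly_star b"
  using poly_star_add[of a "- b"] by simp

lemma gen_of_letter_star [simp]: "gen_of (letter_star l) = gen_of l"
  by (cases l) auto

lemma poly_star_in_free_star [simp]: "a \<in> free_star_carrier X \<Longrightarrow> poly_star a \<in> free_star_carrier X"
  by (induction a rule: free_star_induct) (auto intro!: single_in_free_star)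

fun letter_eval :: "('x \<Rightarrow> complex) \<Rightarrow> 'x letter \<Rightarrow> complex" where
  "letter_eval v (Gen x) = v x"
| "letter_eval v (Adj x) = cnj (v x)"

text \<open>
  The \<open>*\<close>-homomorphism to the complex numbers that sends the generator \<open>x\<close> to \<open>v x\<close>.
\<close>

definition poly_eval :: "('x \<Rightarrow> complex) \<Rightarrow> 'x star_poly \<Rightarrow> complex" where
  "poly_eval v a = (\<Sum>w\<in>Poly_Mapping.keys a. lookup a w * prod_list (map (letter_eval v) w))"

lemma poly_eval_superset:
  assumes "finite S" "Poly_Mapping.keys a \<subseteq> S"
  shows "poly_eval v a = (\<Sum>w\<in>S. lookup a w * prod_list (map (letter_eval v) w))"
  unfolding poly_eval_def using assms
  by (intro sum.mono_neutral_left) (auto simp: in_keys_iff)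

lemma poly_eval_single: "poly_eval v (single w c) = c * prod_list (map (letter_eval v) w)"
  by (subst poly_eval_superset[of "{w}"]) auto

lemma poly_eval_add [simp]: "poly_eval v (a + b) = poly_eval v a + poly_eval v b"
proof -
  let ?S = "Poly_Mapping.keys a \<union> Poly_Mapping.keys b"
  show ?thesis
    using keys_add[of a b]
    by (simp add: poly_eval_superset[of ?S a] poly_eval_superset[of ?S b] poly_eval_superset[of ?S "a + b"]
        lookup_add distrib_right sum.distrib)
qed

lemma poly_eval_mult [simp]: "poly_eval v (a * b) = poly_eval v a * poly_eval v b"
proof (induction a rule: star_poly_induct)
  case (single w c)
  show ?case
    by (induction b rule: star_poly_induct)
       (simp_all add: single_mult poly_eval_single distrib_left)
qed (simp add: distrib_right)

lemma poly_eval_const [simp]: "poly_eval v (const_poly c) = c"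
  by (simp add: const_poly_def poly_eval_single)

lemma poly_eval_0 [simp]: "poly_eval v 0 = 0"
  by (simp add: poly_eval_def)

lemma poly_eval_1 [simp]: "poly_eval v 1 = 1"
  by (simp add: one_single poly_eval_single)

lemma poly_eval_gen [simp]: "poly_eval v (gen_poly x) = v x"
  by (simp add: gen_poly_def poly_eval_single)

lemma poly_eval_uminus [simp]: "poly_eval v (- a) = - poly_eval v a"
  using poly_eval_add[of v a "- a"] by (simp add: eq_neg_iff_add_eq_0 add.commute)

lemma poly_eval_diff [simp]: "poly_eval v (a - b) = poly_eval v a - poly_eval v b"
  using poly_eval_add[of v a "- b"] by simp

lemma poly_eval_sum [simp]: "poly_eval v (sum f I) = (\<Sum>i\<in>I. poly_eval v (f i))"
  by (induction I rule: infinite_finite_induct) auto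

lemma letter_eval_star: "letter_eval v (letter_star l) = cnj (letter_eval v l)"
  by (cases l) auto

lemma poly_eval_star [simp]: "poly_eval v (poly_star a) = cnj (poly_eval v a)"
proof (induction a rule: star_poly_induct)
  case (single w c)
  have "prod_list (map (letter_eval v) (rev (map letter_star w))) = cnj (prod_list (map (letter_eval v) w))"
    by (induction w) (simp_all add: letter_eval_star mult.commute)
  then show ?case by (simp add: poly_eval_single)
qed simp

lemma poly_eval_seminorm:
  assumes "\<And>r. r \<in> R \<Longrightarrow> poly_eval v r = 0"
  shows "(\<lambda>a. cmod (poly_eval v a)) \<in> cstar_seminorms X R"
  using assms
  by (simp add: cstar_seminorms_def norm_mult norm_triangle_ineq power2_eq_square)

lemma cnj_of_bool: "cnj (of_bool b) = of_bool b"
  by (cases b) simp_all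

text \<open>
  The character that evaluates a function on permutations at the point \<open>\<sigma>\<close>.
\<close>

definition perm_eval :: "('v \<Rightarrow> 'v) \<Rightarrow> ('v \<times> 'v) star_poly \<Rightarrow> complex" where
  "perm_eval \<sigma> = poly_eval (\<lambda>(i, j). of_bool (i = \<sigma> j))"

lemma perm_eval_gen: "perm_eval \<sigma> (gen_poly (i, j)) = of_bool (i = \<sigma> j)"
  by (simp add: perm_eval_def)

section \<open>Orthogonality of projections with sum one\<close>

locale cstar_seminorm =
  fixes X :: "'x set" and p :: "'x star_poly \<Rightarrow> real"
  assumes seminorm: "p \<in> cstar_seminorms X {}"
begin

abbreviation F where "F \<equiv> free_star_carrier X"

lemma p_nonneg: "a \<in> F \<Longrightarrow> 0 \<le> p a"
  and p_scale: "a \<in> F \<Longrightarrow> p (const_poly c * a) = cmod c * p a"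
  and p_triangle: "a \<in> F \<Longrightarrow> b \<in> F \<Longrightarrow> p (a + b) \<le> p a + p b"
  and p_submult: "a \<in> F \<Longrightarrow> b \<in> F \<Longrightarrow> p (a * b) \<le> p a * p b"
  and p_cstar: "a \<in> F \<Longrightarrow> p (poly_star a * a) = (p a)\<^sup>2"
  using seminorm unfolding cstar_seminorms_def by blast+

lemma p_zero: "p 0 = 0"
  using p_scale[of 0 0] by simp

lemma p_minus: "a \<in> F \<Longrightarrow> p (- a) = p a"
  using p_scale[of a "- 1"] by (simp add: const_poly_minus)

lemma p_sum: "(\<And>i. i \<in> I \<Longrightarrow> f i \<in> F) \<Longrightarrow> p (sum f I) \<le> (\<Sum>i\<in>I. p (f i))"
proof (induction I rule: infinite_finite_induct)
  case (insert i I)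
  then have "p (sum f (insert i I)) \<le> p (f i) + p (sum f I)" by (simp add: p_triangle)
  then show ?case using insert by fastforce
qed (simp_all add: p_zero)

text \<open>
  Equality in the quotient of the free algebra by the null ideal of \<open>p\<close>.
\<close>

definition cong :: "'x star_poly \<Rightarrow> 'x star_poly \<Rightarrow> bool" (infix "\<approx>" 50) where
  "a \<approx> b \<longleftrightarrow> a \<in> F \<and> b \<in> F \<and> p (a - b) = 0"

lemma cong_refl [simp]: "a \<in> F \<Longrightarrow> a \<approx> a"
  by (simp add: cong_def p_zero)

lemma cong_sym: "a \<approx> b \<Longrightarrow> b \<approx> a"
  using p_minus[of "a - b"] by (simp add: cong_def)

lemma cong_add: "a \<approx> b \<Longrightarrow> c \<approx> d \<Longrightarrow> a + c \<approx> b + d"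
  using p_triangle[of "a - b" "c - d"] p_nonneg[of "(a - b) + (c - d)"]
  by (simp add: cong_def algebra_simps)

lemma cong_trans [trans]: "a \<approx> b \<Longrightarrow> b \<approx> c \<Longrightarrow> a \<approx> c"
  using p_triangle[of "a - b" "b - c"] p_nonneg[of "a - c"] by (simp add: cong_def)

lemma cong_minus: "a \<approx> b \<Longrightarrow> - a \<approx> - b"
  using p_minus[of "a - b"] by (simp add: cong_def algebra_simps)

lemma cong_diff: "a \<approx> b \<Longrightarrow> c \<approx> d \<Longrightarrow> a - c \<approx> b - d"
  using cong_add[OF _ cong_minus] by (metis diff_conv_add_uminus)

lemma cong_mult:
  assumes "a \<approx> b" "c \<approx> d"
  shows "a * c \<approx> b * d"
proof -
  have F: "a \<in> F" "b \<in> F" "c \<in> F" "d \<in> F" and z: "p (a - b) = 0" "p (c - d) = 0"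
    using assms by (simp_all add: cong_def)
  have "a * c - b * d = (a - b) * c + b * (c - d)" by (simp add: algebra_simps)
  then have "p (a * c - b * d) \<le> p ((a - b) * c) + p (b * (c - d))"
    using F by (simp add: p_triangle)
  also have "\<dots> \<le> p (a - b) * p c + p b * p (c - d)"
    using F by (intro add_mono p_submult) simp_all
  finally show ?thesis using z F p_nonneg[of "a * c - b * d"] by (simp add: cong_def)
qed

lemma cong_sum: "(\<And>i. i \<in> I \<Longrightarrow> f i \<approx> g i) \<Longrightarrow> sum f I \<approx> sum g I"
  by (induction I rule: infinite_finite_induct) (auto intro: cong_add)

lemma cong_p: "a \<approx> b \<Longrightarrow> p a = p b"
  using p_triangle[of "a - b" b] p_triangle[of "b - a" a] p_minus[of "a - b"] by (simp add: cong_def)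

lemma cong_0_iff: "a \<in> F \<Longrightarrow> a \<approx> 0 \<longleftrightarrow> p a = 0"
  by (simp add: cong_def)

definition projection :: "'x star_poly \<Rightarrow> bool" where
  "projection q \<longleftrightarrow> q * q \<approx> q \<and> poly_star q \<approx> q \<and> q \<in> F"

lemma projection_norm: "projection q \<Longrightarrow> p q \<le> 1"
proof -
  assume q: "projection q"
  then have "poly_star q * q \<approx> q * q" by (auto simp: projection_def intro: cong_mult)
  also have "q * q \<approx> q" using q by (simp add: projection_def)
  finally have "(p q)\<^sup>2 = p q" using p_cstar[of q] q cong_p by (metis projection_def)
  then show ?thesis by (auto simp: power2_eq_square)
qed

lemma projection_complement: "projection q \<Longrightarrow> projection (1 - q)"
proof -
  assume q: "projection q"
  have "(1 - q) * (1 - q) = 1 - q - (q - q * q)" by (simp add: algebra_simps)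
  also have "\<dots> \<approx> 1 - q - (q - q)"
    using q by (intro cong_diff cong_refl) (auto simp: projection_def)
  finally have "(1 - q) * (1 - q) \<approx> 1 - q" by simp
  then show ?thesis using q by (auto simp: projection_def intro: cong_diff)
qed

text \<open>
  In a \<open>C\<^sup>*\<close>-algebra the hypotheses say that the self-adjoint element \<open>T\<close> of the corner \<open>e A e\<close> satisfies
  \<open>\<parallel>e \<plusminus> s T\<parallel> \<le> 1\<close>, which is possible only for \<open>T = 0\<close> by spectral theory.  Here is an argument that
  works without completeness.  Let \<open>W\<close> be the set of all complex \<open>w\<close> with \<open>\<parallel>e + w T\<parallel> \<le> 1\<close>.  By the
  \<open>C\<^sup>*\<close>-identity, \<open>\<parallel>e \<plusminus> i s T\<parallel>\<^sup>2 = \<parallel>e + s\<^sup>2 T\<^sup>2\<parallel>\<close>, and this element is the mean of the squares of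
  \<open>e + s T\<close> and \<open>e - s T\<close>, so \<open>W\<close> contains \<open>\<plusminus> s\<close> and \<open>\<plusminus> i s\<close>.  If \<open>W\<close> contains \<open>w\<close> and \<open>i w\<close>, then it
  contains \<open>(1 + i) w\<close>, because \<open>w\<^sup>2 + (i w)\<^sup>2 = 0\<close> and so the mean of the squares of \<open>e + w T\<close> and
  \<open>e + i w T\<close> is \<open>e + (1 + i) w T\<close>.  Applied to \<open>\<plusminus> w\<close> and \<open>\<plusminus> i w\<close> at once, this step can be repeated.
  Hence \<open>W\<close> is unbounded, while \<open>|w| \<parallel>T\<parallel> \<le> 2\<close> on \<open>W\<close>.
\<close>

lemma corner_squeeze:
  assumes e: "projection e" and T: "T \<in> F" and Ts: "poly_star T \<approx> T"
    and eT: "e * T \<approx> T" and Te: "T * e \<approx> T" and s: "0 < s"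
    and pos: "p (e + const_poly (complex_of_real s) * T) \<le> 1"
    and neg: "p (e + const_poly (complex_of_real (- s)) * T) \<le> 1"
  shows "T \<approx> 0"
proof -
  define E where "E w = e + const_poly w * T" for w
  \<comment> \<open>The products of the elements \<open>E w\<close> are quadratic in \<open>T\<close>, of the form \<open>Q\<close>.\<close>
  define Q where "Q w z = e + const_poly w * T + const_poly z * (T * T)" for w z
  have eF: "e \<in> F" and ee: "e * e \<approx> e" and es: "poly_star e \<approx> e"
    using e by (auto simp: projection_def)
  have EF: "E w \<in> F" for w using eF T by (simp add: E_def)
  have mult: "E w * E z \<approx> Q (w + z) (w * z)" for w z
  proof -
    have "E w * E z = e * e + (const_poly z * (e * T) + const_poly w * (T * e)) + const_poly (w * z) * (T * T)"
    proof -
      have "const_poly w * T * (const_poly z * T) = const_poly (w * z) * (T * T)"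
        unfolding mult.assoc by (subst const_poly_left_commute) (rule const_poly_assoc)
      moreover have "e * (const_poly z * T) = const_poly z * (e * T)"
        by (rule const_poly_left_commute)
      moreover have "const_poly w * T * e = const_poly w * (T * e)"
        by (rule mult.assoc)
      ultimately show ?thesis by (simp only: E_def distrib_left distrib_right add_ac)
    qed
    also have "\<dots> \<approx> e + (const_poly z * T + const_poly w * T) + const_poly (w * z) * (T * T)"
      by (intro cong_add cong_mult cong_refl ee eT Te) (simp_all add: T)
    also have "\<dots> = Q (w + z) (w * z)"
      by (simp add: Q_def const_poly_add algebra_simps)
    finally show ?thesis .
  qed
  have average: "p (Q (w + z) ((w\<^sup>2 + z\<^sup>2) / 2)) \<le> 1" if w: "p (E w) \<le> 1" and z: "p (E z) \<le> 1" for w z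
  proof -
    have "const_poly (1 / 2) * (E w * E w + E z * E z) \<approx> const_poly (1 / 2) * (Q (w + w) (w * w) + Q (z + z) (z * z))"
      by (intro cong_add cong_mult mult cong_refl) simp
    also have "\<dots> = (const_poly (1/2) * e + const_poly (1/2) * e)
        + (const_poly (1/2 * (w + w)) * T + const_poly (1/2 * (z + z)) * T)
        + (const_poly (1/2 * (w * w)) * (T * T) + const_poly (1/2 * (z * z)) * (T * T))"
      by (simp only: Q_def distrib_left[of "const_poly _"] const_poly_assoc add_ac)
    also have "\<dots> = const_poly (1/2 + 1/2) * e + const_poly (1/2 * (w + w) + 1/2 * (z + z)) * T
        + const_poly (1/2 * (w * w) + 1/2 * (z * z)) * (T * T)"
      by (simp only: const_poly_add distrib_right)
    also have "\<dots> = Q (w + z) ((w\<^sup>2 + z\<^sup>2) / 2)"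
      by (simp add: Q_def power2_eq_square add_divide_distrib)
    finally have "p (Q (w + z) ((w\<^sup>2 + z\<^sup>2) / 2)) = p (const_poly (1 / 2) * (E w * E w + E z * E z))"
      using cong_p by metis
    also have "\<dots> = p (E w * E w + E z * E z) / 2"
      using EF by (subst p_scale) (simp_all add: norm_divide)
    also have "\<dots> \<le> (p (E w) * p (E w) + p (E z) * p (E z)) / 2"
      using EF p_triangle[of "E w * E w" "E z * E z"] p_submult[of "E w" "E w"] p_submult[of "E z" "E z"]
      by simp
    also have "\<dots> \<le> (1 * 1 + 1 * 1) / 2"
      using w z EF p_nonneg by (intro divide_right_mono add_mono mult_mono) simp_all
    finally show ?thesis by simp
  qed
  have pm: "p (E (complex_of_real s)) \<le> 1" "p (E (- complex_of_real s)) \<le> 1"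
    using pos neg by (simp_all add: E_def)
  have imag: "p (E w) \<le> 1" if w: "w = \<i> * s \<or> w = - (\<i> * s)" for w
  proof -
    have "poly_star (E w) = poly_star e + const_poly (- w) * poly_star T"
      using w by (auto simp: E_def const_poly_commute)
    also have "\<dots> \<approx> E (- w)"
      unfolding E_def by (intro cong_add cong_mult es Ts cong_refl) simp
    finally have "poly_star (E w) * E w \<approx> E (- w) * E w"
      using EF by (intro cong_mult cong_refl)
    also have "\<dots> \<approx> Q (- w + w) (- w * w)" by (rule mult)
    also have "\<dots> = Q (complex_of_real s + - complex_of_real s)
        (((complex_of_real s)\<^sup>2 + (- complex_of_real s)\<^sup>2) / 2)"
      using w by (auto simp: power2_eq_square algebra_simps)
    finally have "(p (E w))\<^sup>2 \<le> 1"
      using average[OF pm] p_cstar[OF EF] cong_p by metis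
    then show ?thesis using abs_le_square_iff[of "p (E w)" 1] by simp
  qed
  have rotate: "p (E ((1 + \<i>) * w)) \<le> 1" if "p (E w) \<le> 1" "p (E (\<i> * w)) \<le> 1" for w
    using average[OF that] by (simp add: Q_def E_def distrib_right power_mult_distrib)
  have "p (E ((1 + \<i>) ^ n * s)) \<le> 1 \<and> p (E (\<i> * ((1 + \<i>) ^ n * s))) \<le> 1 \<and>
    p (E (- ((1 + \<i>) ^ n * s))) \<le> 1 \<and> p (E (- (\<i> * ((1 + \<i>) ^ n * s)))) \<le> 1" for n
  proof (induction n)
    case 0
    then show ?case using pm imag by simp
  next
    case (Suc n)
    define w where "w = (1 + \<i>) ^ n * complex_of_real s"
    have "p (E ((1 + \<i>) * w)) \<le> 1" "p (E ((1 + \<i>) * (\<i> * w))) \<le> 1"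
      "p (E ((1 + \<i>) * (- w))) \<le> 1" "p (E ((1 + \<i>) * (- (\<i> * w)))) \<le> 1"
      using Suc by (intro rotate; simp add: w_def mult.assoc[symmetric])+
    then show ?case by (simp add: w_def mult_ac)
  qed
  then have E1: "p (E ((1 + \<i>) ^ n * s)) \<le> 1" for n by blast
  have bound: "sqrt 2 ^ n * s * p T \<le> 2" for n
  proof -
    define w where "w = (1 + \<i>) ^ n * complex_of_real s"
    have "cmod (1 + \<i>) = sqrt 2" by (simp add: cmod_def)
    then have "sqrt 2 ^ n * s * p T = p (const_poly w * T)"
      using T s by (simp add: p_scale w_def norm_mult norm_power)
    also have "const_poly w * T = E w + - e" by (simp add: E_def)
    also have "p (E w + - e) \<le> p (E w) + p e"
      using p_triangle[of "E w" "- e"] p_minus[of e] EF eF by simp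
    also have "\<dots> \<le> 2" using E1[of n] projection_norm[OF e] by (simp add: w_def)
    finally show ?thesis .
  qed
  have "p T = 0"
  proof (rule ccontr)
    assume "p T \<noteq> 0"
    then have pos: "0 < s * p T" using p_nonneg[OF T] s by simp
    obtain n where "2 / (s * p T) < sqrt 2 ^ n" using real_arch_pow[of "sqrt 2"] by auto
    then show False using bound[of n] pos by (simp add: field_simps)
  qed
  then show ?thesis using T by (simp add: cong_0_iff)
qed

lemma projection_corner_norm:
  assumes e: "projection e" and q: "projection q"
  shows "p (e - e * q * e) \<le> 1"
proof -
  have F: "e \<in> F" "q \<in> F" using e q by (auto simp: projection_def)
  have "e * e - e * q * e \<approx> e - e * q * e"
    using e F by (intro cong_diff cong_refl) (auto simp: projection_def)
  moreover have "e * e - e * q * e = e * ((1 - q) * e)" by (simp add: algebra_simps)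
  ultimately have "p (e - e * q * e) = p (e * ((1 - q) * e))" using cong_p by metis
  also have "\<dots> \<le> p e * (p (1 - q) * p e)"
    using F p_submult[of e "(1 - q) * e"] p_submult[of "1 - q" e] p_nonneg[of e]
    by (smt (verit) free_star_diff free_star_mult free_star_one mult_left_mono)
  also have "\<dots> \<le> 1 * (1 * 1)"
    using projection_norm[OF e] projection_norm[OF projection_complement[OF q]] F p_nonneg
    by (intro mult_mono) simp_all
  finally show ?thesis by simp
qed

text \<open>
  With \<open>e = q j\<close> the elements \<open>h k = e (q k) e\<close> sum to \<open>e\<close> and \<open>h j = e\<close>, so those with \<open>k \<noteq> j\<close> sum to
  zero.  Since \<open>\<parallel>e - h k\<parallel> \<le> 1\<close> for every \<open>k\<close>, writing \<open>h l\<close> as minus the sum of the remaining ones bounds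
  \<open>c e + h l\<close> by \<open>c\<close>, where \<open>c\<close> is one more than their number; the same bound for \<open>c e - h l\<close> is
  immediate.  Thus \<open>h l = (q l e)\<^sup>* (q l e)\<close> vanishes by \<open>corner_squeeze\<close>.
\<close>

lemma projections_orthogonal:
  assumes fin: "finite K" and proj: "\<And>k. k \<in> K \<Longrightarrow> projection (q k)" and sum1: "(\<Sum>k\<in>K. q k) \<approx> 1"
    and j: "j \<in> K" and l: "l \<in> K" and "j \<noteq> l"
  shows "q l * q j \<approx> 0"
proof -
  define e where "e = q j"
  define h where "h k = e * q k * e" for k
  define M where "M = K - {j, l}"
  define c where "c = Suc (card M)"
  have e: "projection e" using proj j by (simp add: e_def)
  have qF: "q k \<in> F" if "k \<in> K" for k using proj[OF that] by (simp add: projection_def)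
  have eF: "e \<in> F" and ee: "e * e \<approx> e" and es: "poly_star e \<approx> e" using e by (auto simp: projection_def)
  have hF: "h k \<in> F" if "k \<in> K" for k using that qF eF by (simp add: h_def)
  have finM: "finite M" and MK: "\<And>k. k \<in> M \<Longrightarrow> k \<in> K" and K: "K = insert j (insert l M)"
    and ni: "j \<notin> insert l M" "l \<notin> M"
    using fin j l \<open>j \<noteq> l\<close> by (auto simp: M_def)
  have eq_e: "p (e - h k) \<le> 1" if "k \<in> K" for k
    unfolding h_def using projection_corner_norm[OF e proj[OF that]] .
  have eee: "e * e * e \<approx> e"
    using cong_trans[OF cong_mult[OF ee cong_refl[OF eF]] ee] .
  have "h j + (h l + sum h M) = (\<Sum>k\<in>K. h k)" using K ni finM by simp
  also have "\<dots> = e * (\<Sum>k\<in>K. q k) * e" by (simp add: h_def sum_distrib_left sum_distrib_right)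
  also have "\<dots> \<approx> e * 1 * e" by (intro cong_mult sum1 cong_refl eF)
  also have "e * 1 * e \<approx> e" using ee by simp
  finally have "h j + (h l + sum h M) - h j \<approx> e - e"
    using eee by (intro cong_diff) (simp_all add: h_def e_def)
  then have rest: "h l + sum h M \<approx> 0" by simp
  have cM: "const_poly (of_nat m) * e = (\<Sum>k<m. e)" for m
    by (induction m) (simp_all add: const_poly_add distrib_right add.commute)
  then have cM: "const_poly (of_nat (card M)) * e = (\<Sum>k\<in>M. e)"
    by simp
  have cc: "const_poly (of_nat c) * e = e + const_poly (of_nat (card M)) * e"
    by (simp add: c_def const_poly_add distrib_right)
  have hlF: "h l \<in> F" using hF l by simp
  have sumF: "(\<Sum>k\<in>M. e - h k) \<in> F" using hF MK eF by simp
  have up: "p (const_poly (of_nat c) * e + h l) \<le> c"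
  proof -
    have "const_poly (of_nat c) * e + h l = (e + (\<Sum>k\<in>M. e - h k)) + (h l + sum h M)"
      by (simp add: cc cM sum_subtractf)
    also have "\<dots> \<approx> (e + (\<Sum>k\<in>M. e - h k)) + 0"
      using rest eF sumF by (intro cong_add cong_refl) simp_all
    finally have "p (const_poly (of_nat c) * e + h l) = p (e + (\<Sum>k\<in>M. e - h k))"
      using cong_p by fastforce
    also have "\<dots> \<le> p e + p (\<Sum>k\<in>M. e - h k)" using eF sumF by (rule p_triangle)
    also have "\<dots> \<le> 1 + (\<Sum>k\<in>M. p (e - h k))"
      using hF MK eF by (intro add_mono projection_norm[OF e] p_sum) simp
    also have "\<dots> \<le> 1 + (\<Sum>k\<in>M. 1)" using eq_e MK by (intro add_mono sum_mono) simp_all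
    finally show ?thesis by (simp add: c_def)
  qed
  have down: "p (const_poly (of_nat c) * e - h l) \<le> c"
  proof -
    have "const_poly (of_nat c) * e - h l = const_poly (of_nat (card M)) * e + (e - h l)" by (simp add: cc)
    then have "p (const_poly (of_nat c) * e - h l) \<le> p (const_poly (of_nat (card M)) * e) + p (e - h l)"
      using eF hlF p_triangle[of "const_poly (of_nat (card M)) * e" "e - h l"]
      by (metis free_star_const free_star_diff free_star_mult)
    also have "\<dots> \<le> real (card M) * 1 + 1"
      using eq_e[OF l] projection_norm[OF e] eF
      by (intro add_mono) (simp_all add: p_scale mult_left_le)
    finally show ?thesis by (simp add: c_def)
  qed
  have c0: "0 < real c" by (simp add: c_def)
  have inv: "const_poly (complex_of_real (1 / c)) * (const_poly (of_nat c) * e) = e"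
    using c0 by (simp add: const_poly_assoc)
  have scale: "p (const_poly (complex_of_real (1 / c)) * x) \<le> 1" if "x \<in> F" "p x \<le> c" for x
    using that c0 by (simp add: p_scale norm_divide field_simps)
  have "h l \<approx> 0"
  proof (rule corner_squeeze[OF e hlF])
    have "poly_star (h l) = poly_star e * (poly_star (q l) * poly_star e)" by (simp add: h_def)
    also have "\<dots> \<approx> e * (q l * e)"
      using proj[OF l] by (intro cong_mult es) (simp add: projection_def)
    finally show "poly_star (h l) \<approx> h l" by (simp add: h_def mult.assoc)
    have "e * e * (q l * e) \<approx> e * (q l * e)"
      using qF[OF l] eF by (intro cong_mult ee cong_refl) simp
    then show "e * h l \<approx> h l" by (simp add: h_def mult.assoc)
    have "e * q l * (e * e) \<approx> e * q l * e"
      using qF[OF l] eF by (intro cong_mult ee cong_refl) simp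
    then show "h l * e \<approx> h l" by (simp add: h_def mult.assoc)
    show "0 < 1 / real c" using c0 by simp
    have "const_poly (complex_of_real (1 / c)) * (const_poly (of_nat c) * e + h l)
      = e + const_poly (complex_of_real (1 / c)) * h l"
      by (simp only: distrib_left inv)
    then show "p (e + const_poly (complex_of_real (1 / c)) * h l) \<le> 1"
      using scale[OF _ up] eF hlF by simp
    have "const_poly (complex_of_real (1 / c)) * (const_poly (of_nat c) * e - h l)
      = e + const_poly (complex_of_real (- (1 / c))) * h l"
      by (simp only: right_diff_distrib inv of_real_minus const_poly_minus) simp
    then show "p (e + const_poly (complex_of_real (- (1 / c))) * h l) \<le> 1"
      using scale[OF _ down] eF hlF by simp
  qed
  have bF: "q l * e \<in> F" using qF l eF by simp
  have "poly_star (q l * e) * (q l * e) = poly_star e * (poly_star (q l) * q l) * e" by (simp add: mult.assoc)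
  also have "\<dots> \<approx> e * (q l * q l) * e"
    using proj[OF l] by (intro cong_mult es cong_refl eF) (auto simp: projection_def)
  also have "\<dots> \<approx> h l"
    unfolding h_def using proj[OF l] by (intro cong_mult cong_refl eF) (auto simp: projection_def)
  also note \<open>h l \<approx> 0\<close>
  finally have "(p (q l * e))\<^sup>2 = 0" using p_cstar[OF bF] cong_p p_zero by metis
  then show ?thesis using bF by (simp add: cong_0_iff e_def)
qed

end

section \<open>Vertex cells seen by a seminorm\<close>

text \<open>
  A seminorm that respects the defining relations of the quantum automorphism group of the graph with
  vertex set \<open>V\<close> and adjacency \<open>A\<close>.
\<close>

locale magic_seminorm =
  cstar_seminorm "V \<times> V" p
  for V :: "'v::linorder set" and p :: "('v \<times> 'v) star_poly \<Rightarrow> real" +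
  fixes A :: "'v \<Rightarrow> 'v \<Rightarrow> bool"
  assumes finV: "finite V" and sympA: "symp A" and irreflpA: "irreflp A"
    and gen_star: "i \<in> V \<Longrightarrow> j \<in> V \<Longrightarrow> p (gen_poly (i, j) - poly_star (gen_poly (i, j))) = 0"
    and gen_idem: "i \<in> V \<Longrightarrow> j \<in> V \<Longrightarrow> p (gen_poly (i, j) - gen_poly (i, j) * gen_poly (i, j)) = 0"
    and gen_row: "i \<in> V \<Longrightarrow> p ((\<Sum>k\<in>V. gen_poly (i, k)) - 1) = 0"
    and gen_col: "i \<in> V \<Longrightarrow> p ((\<Sum>k\<in>V. gen_poly (k, i)) - 1) = 0"
    and gen_commute: "i \<in> V \<Longrightarrow> j \<in> V \<Longrightarrow>
      p ((\<Sum>k\<in>V. gen_poly (i, k) * of_bool (A k j)) - (\<Sum>k\<in>V. of_bool (A i k) * gen_poly (k, j))) = 0"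
begin

notation cong (infix "\<approx>" 50)

abbreviation u where "u i j \<equiv> gen_poly (i, j) :: ('v \<times> 'v) star_poly"
abbreviation \<epsilon> where "\<epsilon> i j \<equiv> of_bool (A i j) :: ('v \<times> 'v) star_poly"

lemma eps_F [simp]: "of_bool b \<in> F"
  by (cases b) simp_all

lemma u_projection: "i \<in> V \<Longrightarrow> j \<in> V \<Longrightarrow> projection (u i j)"
proof -
  assume ij: "i \<in> V" "j \<in> V"
  then have "u i j \<approx> poly_star (u i j)" "u i j \<approx> u i j * u i j"
    by (simp_all add: cong_def gen_star gen_idem)
  then show ?thesis using ij by (auto simp: projection_def intro: cong_sym)
qed

lemma row_sum: "i \<in> V \<Longrightarrow> (\<Sum>k\<in>V. u i k) \<approx> 1"
  by (simp add: cong_def gen_row)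

lemma col_sum: "i \<in> V \<Longrightarrow> (\<Sum>k\<in>V. u k i) \<approx> 1"
  by (simp add: cong_def gen_col)

lemma commute: "i \<in> V \<Longrightarrow> j \<in> V \<Longrightarrow> (\<Sum>k\<in>V. u i k * \<epsilon> k j) \<approx> (\<Sum>k\<in>V. \<epsilon> i k * u k j)"
  by (simp add: cong_def gen_commute)

lemma row_orthogonal: "i \<in> V \<Longrightarrow> j \<in> V \<Longrightarrow> k \<in> V \<Longrightarrow> j \<noteq> k \<Longrightarrow> u i k * u i j \<approx> 0"
  using projections_orthogonal[OF finV _ row_sum] u_projection by blast

definition linked :: "('v \<times> 'v) set" where
  "linked = {(i, j). i \<in> V \<and> j \<in> V \<and> \<not> u i j \<approx> 0}"

definition color :: "'v \<Rightarrow> 'v set" where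
  "color x = (linked \<union> linked\<inverse>)\<^sup>* `` {x}"

lemma color_eq_iff: "color x = color y \<longleftrightarrow> (x, y) \<in> (linked \<union> linked\<inverse>)\<^sup>*"
proof
  assume "color x = color y"
  then have "y \<in> color x" by (simp add: color_def)
  then show "(x, y) \<in> (linked \<union> linked\<inverse>)\<^sup>*" by (simp add: color_def)
next
  assume *: "(x, y) \<in> (linked \<union> linked\<inverse>)\<^sup>*"
  have "sym ((linked \<union> linked\<inverse>)\<^sup>*)" by (intro sym_rtrancl sym_Un_converse)
  then have "(y, x) \<in> (linked \<union> linked\<inverse>)\<^sup>*" using * by (rule symD)
  then show "color x = color y" using * unfolding color_def by (blast intro: rtrancl_trans)
qed

lemma u_zero_if_color_neq: "i \<in> V \<Longrightarrow> j \<in> V \<Longrightarrow> color i \<noteq> color j \<Longrightarrow> u i j \<approx> 0"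
  unfolding color_eq_iff linked_def by blast

text \<open>
  Indicator functions of color classes are fixed by the matrix \<open>u\<close>.
\<close>

lemma color_class_invariant:
  assumes C: "C = {w\<in>V. color w = c}" and l: "l \<in> V"
  shows "(\<Sum>k\<in>C. u l k) \<approx> of_bool (l \<in> C)"
proof (cases "l \<in> C")
  case True
  have "V = C \<union> (V - C)" "C \<inter> (V - C) = {}" "finite C" using C finV by auto
  then have "(\<Sum>k\<in>V. u l k) = (\<Sum>k\<in>C. u l k) + (\<Sum>k\<in>V - C. u l k)"
    by (metis finite_Diff finV sum.union_disjoint)
  moreover have "(\<Sum>k\<in>V - C. u l k) \<approx> (\<Sum>k\<in>V - C. 0)"
    using True C l by (intro cong_sum u_zero_if_color_neq) auto
  ultimately have "(\<Sum>k\<in>V. u l k) - (\<Sum>k\<in>V - C. u l k) \<approx> 1 - 0"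
    using row_sum[OF l] by (intro cong_diff) simp_all
  then show ?thesis using True \<open>(\<Sum>k\<in>V. u l k) = _\<close> by simp
next
  case False
  have "(\<Sum>k\<in>C. u l k) \<approx> (\<Sum>k\<in>C. 0)"
    using False C l by (intro cong_sum u_zero_if_color_neq) auto
  then show ?thesis using False by simp
qed

lemma of_nat_const: "of_nat m = const_poly (of_nat m)"
  by (induction m) (simp_all add: const_poly_add)

text \<open>
  Let \<open>f l\<close> be the number of neighbours of \<open>l\<close> in \<open>C\<close>.  As the indicator of \<open>C\<close> is fixed by \<open>u\<close> and \<open>u\<close>
  commutes with the adjacency matrix, the vector \<open>f\<close> is fixed by \<open>u\<close> as well.  Multiplying row \<open>i\<close> of
  this identity by \<open>u i j\<close> and using orthogonality of the row leaves \<open>f j * u i j = f i * u i j\<close>.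
\<close>

lemma color_degree_linked:
  assumes C: "C = {w\<in>V. color w = c}" and ij: "i \<in> V" "j \<in> V" "\<not> u i j \<approx> 0"
  shows "card {w\<in>C. A i w} = card {w\<in>C. A j w}"
proof -
  define f where "f x = card {w\<in>C. A x w}" for x
  define cf where "cf x = (const_poly (of_nat (f x)) :: ('v \<times> 'v) star_poly)" for x
  have CV: "C \<subseteq> V" and finC: "finite C" using C finV by auto
  have deg: "(\<Sum>k\<in>C. \<epsilon> l k) = cf l" for l
    using card_filter_sum[OF finC, of "A l"]
    by (simp add: cf_def f_def of_nat_const[symmetric] sum_of_bool_eq finC)
  have "(\<Sum>k\<in>C. \<Sum>l\<in>V. u i l * \<epsilon> l k) \<approx> (\<Sum>k\<in>C. \<Sum>l\<in>V. \<epsilon> i l * u l k)"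
    using CV ij by (intro cong_sum commute) auto
  moreover have "(\<Sum>k\<in>C. \<Sum>l\<in>V. u i l * \<epsilon> l k) = (\<Sum>l\<in>V. u i l * cf l)"
    unfolding deg[symmetric] sum_distrib_left by (rule sum.swap)
  moreover have "(\<Sum>k\<in>C. \<Sum>l\<in>V. \<epsilon> i l * u l k) = (\<Sum>l\<in>V. \<epsilon> i l * (\<Sum>k\<in>C. u l k))"
    unfolding sum_distrib_left by (rule sum.swap)
  ultimately have "(\<Sum>l\<in>V. u i l * cf l) \<approx> (\<Sum>l\<in>V. \<epsilon> i l * (\<Sum>k\<in>C. u l k))" by simp
  also have "\<dots> \<approx> (\<Sum>l\<in>V. \<epsilon> i l * of_bool (l \<in> C))"
    using color_class_invariant[OF C] by (intro cong_sum cong_mult cong_refl) simp_all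
  also have "\<dots> = (\<Sum>l\<in>C. \<epsilon> i l)"
    using CV finV by (intro sum.mono_neutral_cong_right) auto
  also have "\<dots> = cf i" by (rule deg)
  finally have L1: "(\<Sum>l\<in>V. u i l * cf l) * u i j \<approx> cf i * u i j"
    using ij by (intro cong_mult cong_refl) simp_all
  have L2: "(\<Sum>l\<in>V. u i l * cf l) * u i j \<approx> (\<Sum>l\<in>V. if l = j then cf j * u i j else 0)"
    unfolding sum_distrib_right
  proof (rule cong_sum)
    fix l assume l: "l \<in> V"
    have "u i l * cf l * u i j = cf l * (u i l * u i j)"
      by (simp add: cf_def const_poly_commute mult.assoc)
    also have "\<dots> \<approx> cf l * (if l = j then u i j else 0)"
      using l ij u_projection[of i j] row_orthogonal[of i j l]
      by (intro cong_mult cong_refl) (auto simp: cf_def projection_def)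
    also have "\<dots> = (if l = j then cf j * u i j else 0)" by simp
    finally show "u i l * cf l * u i j \<approx> (if l = j then cf j * u i j else 0)" .
  qed
  have "(\<Sum>l\<in>V. if l = j then cf j * u i j else 0) = cf j * u i j" using ij finV by simp
  with L2 have "cf j * u i j \<approx> cf i * u i j" using cong_trans[OF cong_sym L1] by simp
  then have "p (const_poly (of_nat (f j) - of_nat (f i)) * u i j) = 0"
    by (simp add: cong_def cf_def left_diff_distrib const_poly_diff)
  then have "(of_nat (f j) :: complex) = of_nat (f i)"
    using ij by (simp add: p_scale cong_0_iff)
  then show ?thesis by (simp add: f_def)
qed

lemma color_equitable:
  assumes "color x = color y" and "x \<in> V" "y \<in> V"
  shows "card {w \<in> {w\<in>V. color w = c}. A x w} = card {w \<in> {w\<in>V. color w = c}. A y w}"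
proof -
  have "(x, y) \<in> (linked \<union> linked\<inverse>)\<^sup>*" using assms color_eq_iff by simp
  then show ?thesis
  proof induction
    case (step y z)
    then show ?case
      using color_degree_linked[OF refl, of _ _ c] unfolding linked_def by auto
  qed simp
qed

section \<open>Graphs with at most two automorphisms\<close>

abbreviation cell where "cell x \<equiv> {w\<in>V. color w = color x}"

text \<open>
  A singleton cell has its vertex as its own partner, so that \<open>partner\<close> is an involution of the vertex set
  as soon as no cell has more than two vertices.
\<close>

definition partner :: "'v \<Rightarrow> 'v" where
  "partner x = (if x \<in> V \<and> (\<exists>y\<in>cell x. y \<noteq> x) then SOME y. y \<in> cell x \<and> y \<noteq> x else x)"

text \<open>
  The projection that governs the cell of \<open>x\<close>, set to 0 on singletons so that
  \<open>u x x = 1 - flip x\<close> holds for all \<open>x\<close>.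
\<close>

definition flip :: "'v \<Rightarrow> ('v \<times> 'v) star_poly" where
  "flip x = (if partner x = x then 0 else gen_poly (x, partner x))"

definition flip_map :: "('v \<times> 'v) star_poly \<Rightarrow> 'v \<Rightarrow> 'v" where
  "flip_map q x = (if x \<in> V \<and> flip x \<approx> q then partner x else x)"

end

locale small_magic_seminorm = magic_seminorm +
  assumes V7: "card V \<le> 7" and few: "card (graph_auts V A) < 3"
begin

lemma cell_card: "x \<in> V \<Longrightarrow> card (cell x) \<le> 2"
  by (rule equitable_cell_card_le_2[OF finV V7 sympA irreflpA color_equitable few])

lemma cell_eq:
  assumes x: "x \<in> V"
  shows "cell x = {x, partner x}"
proof (cases "\<exists>y\<in>cell x. y \<noteq> x")
  case True
  then have "partner x \<in> cell x \<and> partner x \<noteq> x"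
    using x someI_ex[of "\<lambda>y. y \<in> cell x \<and> y \<noteq> x"] by (auto simp: partner_def)
  then have "{x, partner x} \<subseteq> cell x" "card {x, partner x} = 2" using x by auto
  then show ?thesis using cell_card[OF x] finV card_seteq[of "cell x" "{x, partner x}"] by simp
next
  case False
  then show ?thesis using x by (auto simp: partner_def)
qed

lemma partner_in: "x \<in> V \<Longrightarrow> partner x \<in> V" and color_partner: "x \<in> V \<Longrightarrow> color (partner x) = color x"
  using cell_eq[of x] by blast+

lemma same_color: "x \<in> V \<Longrightarrow> z \<in> V \<Longrightarrow> color z = color x \<Longrightarrow> z = x \<or> z = partner x"
  using cell_eq[of x] by blast

lemma partner_partner: "x \<in> V \<Longrightarrow> partner (partner x) = x"
proof -
  assume x: "x \<in> V"
  have "{partner x, partner (partner x)} = {x, partner x}"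
    using cell_eq[OF x] cell_eq[OF partner_in[OF x]] color_partner[OF x] by simp
  then show ?thesis by (metis doubleton_eq_iff)
qed

lemma u_zero: "x \<in> V \<Longrightarrow> z \<in> V \<Longrightarrow> z \<noteq> x \<Longrightarrow> z \<noteq> partner x \<Longrightarrow> u x z \<approx> 0"
  using u_zero_if_color_neq[of x z] same_color[of x z] by metis

lemma u_zero': "x \<in> V \<Longrightarrow> z \<in> V \<Longrightarrow> z \<noteq> x \<Longrightarrow> z \<noteq> partner x \<Longrightarrow> u z x \<approx> 0"
  using u_zero[of z x] partner_partner[of z] by metis

lemma sum_support:
  assumes x: "x \<in> V" and g: "\<And>k. k \<in> V \<Longrightarrow> g k \<in> F"
    and z: "\<And>k. k \<in> V \<Longrightarrow> k \<noteq> x \<Longrightarrow> k \<noteq> partner x \<Longrightarrow> g k \<approx> 0"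
  shows "(\<Sum>k\<in>V. g k) \<approx> g x + (if partner x = x then 0 else g (partner x))"
proof -
  have "(\<Sum>k\<in>V. g k) \<approx> (\<Sum>k\<in>V. if k = x \<or> k = partner x then g k else 0)"
    using g z by (intro cong_sum) auto
  also have "\<dots> = (\<Sum>k\<in>{x, partner x}. g k)"
    using x partner_in[OF x] finV by (intro sum.mono_neutral_cong_right) auto
  also have "\<dots> = g x + (if partner x = x then 0 else g (partner x))" by auto
  finally show ?thesis .
qed

lemma flip_F [simp]: "x \<in> V \<Longrightarrow> flip x \<in> F"
  by (simp add: flip_def partner_in)

lemma flip_projection: "x \<in> V \<Longrightarrow> projection (flip x)"
  using u_projection[of x "partner x"] partner_in[of x] by (auto simp: flip_def projection_def)

lemma u_diag: "x \<in> V \<Longrightarrow> u x x \<approx> 1 - flip x"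
proof -
  assume x: "x \<in> V"
  have "u x x + flip x = u x x + (if partner x = x then 0 else u x (partner x))"
    by (simp add: flip_def)
  also have "\<dots> \<approx> (\<Sum>k\<in>V. u x k)"
    by (rule cong_sym, rule sum_support[OF x]) (use x u_zero in simp_all)
  also have "\<dots> \<approx> 1" by (rule row_sum[OF x])
  finally have "u x x + flip x - flip x \<approx> 1 - flip x"
    using x by (intro cong_diff cong_refl) simp_all
  then show ?thesis by simp
qed

lemma u_partner: "x \<in> V \<Longrightarrow> partner x \<noteq> x \<Longrightarrow> u (partner x) x \<approx> flip x"
proof -
  assume x: "x \<in> V" and ne: "partner x \<noteq> x"
  have "u x x + u (partner x) x = u x x + (if partner x = x then 0 else u (partner x) x)"
    using ne by simp
  also have "\<dots> \<approx> (\<Sum>k\<in>V. u k x)"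
    by (rule cong_sym, rule sum_support[OF x]) (use x u_zero' in simp_all)
  also have "\<dots> \<approx> 1" by (rule col_sum[OF x])
  finally have "u x x + u (partner x) x - u x x \<approx> 1 - (1 - flip x)"
    by (intro cong_diff u_diag x)
  then show ?thesis by simp
qed

lemma flip_partner: "x \<in> V \<Longrightarrow> flip (partner x) \<approx> flip x"
proof -
  assume x: "x \<in> V"
  show ?thesis
  proof (cases "partner x = x")
    case False
    then have "flip (partner x) = u (partner x) x" using partner_partner[OF x] by (auto simp: flip_def)
    then show ?thesis using u_partner[OF x False] by simp
  qed (use x in simp)
qed

text \<open>
  The entry \<open>(x, y)\<close> of \<open>u \<epsilon> = \<epsilon> u\<close>; each row and each column of \<open>u\<close> has at most two nonzero entries.
\<close>

lemma flip_exchange: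
  assumes x: "x \<in> V" and y: "y \<in> V"
  shows "(1 - flip x) * \<epsilon> x y + flip x * \<epsilon> (partner x) y \<approx> \<epsilon> x y * (1 - flip y) + \<epsilon> x (partner y) * flip y"
proof -
  have "(1 - flip x) * \<epsilon> x y + flip x * \<epsilon> (partner x) y
      = (1 - flip x) * \<epsilon> x y + (if partner x = x then 0 else u x (partner x) * \<epsilon> (partner x) y)"
    by (simp add: flip_def)
  also have "\<dots> \<approx> u x x * \<epsilon> x y + (if partner x = x then 0 else u x (partner x) * \<epsilon> (partner x) y)"
    using x partner_in[OF x] by (intro cong_add cong_mult cong_sym[OF u_diag] cong_refl) auto
  also have "\<dots> \<approx> (\<Sum>k\<in>V. u x k * \<epsilon> k y)"
    by (rule cong_sym, rule sum_support[OF x])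
       (use x cong_mult[OF u_zero cong_refl[OF eps_F]] in auto)
  also have "\<dots> \<approx> (\<Sum>k\<in>V. \<epsilon> x k * u k y)" by (rule commute[OF x y])
  also have "\<dots> \<approx> \<epsilon> x y * u y y + (if partner y = y then 0 else \<epsilon> x (partner y) * u (partner y) y)"
    by (rule sum_support[OF y]) (use y cong_mult[OF cong_refl[OF eps_F] u_zero'] in auto)
  also have "\<dots> \<approx> \<epsilon> x y * (1 - flip y) + (if partner y = y then 0 else \<epsilon> x (partner y) * flip y)"
    using y partner_in[OF y] u_partner[OF y] by (intro cong_add cong_mult u_diag cong_refl) (auto intro!: cong_mult)
  also have "\<dots> = \<epsilon> x y * (1 - flip y) + \<epsilon> x (partner y) * flip y"
    by (simp add: flip_def)
  finally show ?thesis .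
qed

text \<open>
  If \<open>x\<close> and its partner differ in their adjacency to \<open>y\<close>, then \<open>flip_exchange\<close> expresses \<open>flip x\<close> by
  \<open>flip y\<close>, and the pair of \<open>y\<close> must be matched with the pair of \<open>x\<close>.
\<close>

lemma flip_adjacency:
  assumes x: "x \<in> V" and y: "y \<in> V" and ne: "A (partner x) y \<noteq> A x y" and nz: "\<not> flip x \<approx> 0"
  shows "flip x \<approx> flip y" and "A x (partner y) \<noteq> A x y"
proof -
  note ex = flip_exchange[OF x y]
  have "flip x \<approx> flip y \<and> A x (partner y) \<noteq> A x y"
  proof (cases "A x y"; cases "A x (partner y)")
    assume "A x y" "A x (partner y)"
    then have "1 - flip x \<approx> 1" using ex ne by simp
    then have "1 - (1 - flip x) \<approx> 1 - 1" by (intro cong_diff cong_refl) simp_all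
    then show ?thesis using nz by simp
  next
    assume a: "A x y" "\<not> A x (partner y)"
    then have "1 - flip x \<approx> 1 - flip y" using ex ne by simp
    then have "1 - (1 - flip x) \<approx> 1 - (1 - flip y)" by (rule cong_diff[OF cong_refl[OF free_star_one]])
    then show ?thesis using a by simp
  next
    assume a: "\<not> A x y" "A x (partner y)"
    then show ?thesis using ex ne by simp
  next
    assume "\<not> A x y" "\<not> A x (partner y)"
    then show ?thesis using ex ne nz by simp
  qed
  then show "flip x \<approx> flip y" "A x (partner y) \<noteq> A x y" by auto
qed

lemma flip_map_in: "x \<in> V \<Longrightarrow> flip_map q x \<in> V"
  by (simp add: flip_map_def partner_in)

lemma flip_map_flip_map: "flip_map q (flip_map q x) = x"
proof (cases "x \<in> V \<and> flip x \<approx> q")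
  case True
  then have "flip (partner x) \<approx> q" using flip_partner cong_trans by blast
  then show ?thesis using True by (simp add: flip_map_def partner_in partner_partner)
qed (auto simp: flip_map_def)

lemma flip_map_aut:
  assumes q: "\<not> q \<approx> 0"
  shows "flip_map q \<in> graph_auts V A"
proof -
  note cc = symp_iff[OF sympA]
  have "bij_betw (flip_map q) V V"
    by (rule bij_betw_byWitness[where f' = "flip_map q"]) (auto simp: flip_map_flip_map flip_map_in)
  then have perm: "flip_map q permutes V"
    by (rule bij_imp_permutes) (simp add: flip_map_def)
  have nz: "\<not> flip x \<approx> 0" if "flip x \<approx> q" for x
    using cong_trans[OF cong_sym[OF that], of 0] q by blast
  have one: "A (partner x) y \<longleftrightarrow> A x y" if xy: "x \<in> V" "y \<in> V" "flip x \<approx> q" "\<not> flip y \<approx> q" for x y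
  proof (rule ccontr)
    assume "(A (partner x) y) \<noteq> (A x y)"
    from cong_trans[OF cong_sym[OF flip_adjacency(1)[OF xy(1,2) this nz[OF xy(3)]]] xy(3)]
    show False using xy(4) by blast
  qed
  \<comment> \<open>If both pairs are exchanged, then \<open>flip_adjacency\<close> applies in both directions.\<close>
  have swap: "A (partner x) y \<longleftrightarrow> A x (partner y)" if xy: "x \<in> V" "y \<in> V" "flip x \<approx> q" "flip y \<approx> q" for x y
  proof -
    have "A x (partner y) \<noteq> A x y" if "A (partner x) y \<noteq> A x y"
      using flip_adjacency(2)[OF xy(1,2) that nz[OF xy(3)]] .
    moreover have "A y (partner x) \<noteq> A y x" if "A (partner y) x \<noteq> A y x"
      using flip_adjacency(2)[OF xy(2,1) that nz[OF xy(4)]] .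
    ultimately show ?thesis
      using cc[of x y] cc[of "partner y" x] cc[of y "partner x"] by argo
  qed
  have two: "A (partner x) (partner y) \<longleftrightarrow> A x y" if "x \<in> V" "y \<in> V" "flip x \<approx> q" "flip y \<approx> q" for x y
    using swap[OF that(1) partner_in[OF that(2)] that(3)] cong_trans[OF flip_partner[OF that(2)] that(4)]
      partner_partner[OF that(2)] by simp
  have "A (flip_map q x) (flip_map q y) \<longleftrightarrow> A x y" if "x \<in> V" "y \<in> V" for x y
    using that one[of x y] one[of y x] two[of x y] cc[of x y] cc[of "partner y" x] by (auto simp: flip_map_def)
  then show ?thesis using perm by (simp add: graph_auts_def)
qed

text \<open>
  Two different nonzero projections would yield two different nontrivial automorphisms.
\<close>

lemma flips_agree:
  assumes "a \<in> V" "b \<in> V" "\<not> flip a \<approx> 0" "\<not> flip b \<approx> 0"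
  shows "flip a \<approx> flip b"
proof (rule ccontr)
  assume n: "\<not> flip a \<approx> flip b"
  have moved: "partner x \<noteq> x" if "\<not> flip x \<approx> 0" for x using that by (auto simp: flip_def)
  have "flip_map (flip a) a = partner a" "flip_map (flip b) b = partner b" "flip_map (flip b) a = a"
    using assms n by (simp_all add: flip_map_def)
  then have "flip_map (flip a) \<noteq> id" "flip_map (flip b) \<noteq> id" "flip_map (flip a) \<noteq> flip_map (flip b)"
    using moved assms(3,4) by (metis id_apply)+
  then show False
    using three_graph_auts[OF finV flip_map_aut[OF assms(3)] flip_map_aut[OF assms(4)]] few by linarith
qed

lemma two_point_form:
  "\<exists>q \<tau>. projection q \<and> \<tau> \<in> graph_auts V A \<and>
     (\<forall>x\<in>V. \<forall>z\<in>V. u x z \<approx> of_bool (x = z) * (1 - q) + of_bool (x = \<tau> z) * q)"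
proof (cases "\<exists>a\<in>V. \<not> flip a \<approx> 0")
  case False
  have "u x z \<approx> of_bool (x = z)" if x: "x \<in> V" and z: "z \<in> V" for x z
  proof (cases "z = x")
    case True
    have "1 - flip x \<approx> 1 - 0" using False x by (intro cong_diff cong_refl) auto
    then show ?thesis using cong_trans[OF u_diag[OF x]] True by simp
  next
    case zx: False
    have "u x z \<approx> 0"
    proof (cases "z = partner x")
      case True
      then have "flip x = u x z" using zx by (simp add: flip_def)
      then show ?thesis using False x by auto
    qed (use u_zero x z zx in blast)
    then show ?thesis using zx by simp
  qed
  then have "\<forall>x\<in>V. \<forall>z\<in>V. u x z \<approx> of_bool (x = z) * (1 - 0) + of_bool (x = id z) * 0" by simp
  moreover have "projection 0" by (simp add: projection_def)
  ultimately show ?thesis using id_in_graph_auts by blast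
next
  case True
  then obtain a where a: "a \<in> V" "\<not> flip a \<approx> 0" by blast
  define q where "q = flip a"
  define \<tau> where "\<tau> = flip_map q"
  have qF: "q \<in> F" and nz: "\<not> q \<approx> 0" using a by (simp_all add: q_def)
  have dich: "flip x \<approx> 0 \<and> \<tau> x = x \<or> flip x \<approx> q \<and> \<tau> x = partner x \<and> partner x \<noteq> x" if x: "x \<in> V" for x
  proof (cases "flip x \<approx> 0")
    case True
    then have "\<not> flip x \<approx> q" using nz cong_sym cong_trans by blast
    then show ?thesis using True by (simp add: \<tau>_def flip_map_def)
  next
    case False
    then have "flip x \<approx> q" using flips_agree[OF x a(1) False a(2)] by (simp add: q_def)
    moreover have "partner x \<noteq> x" using False by (auto simp: flip_def)
    ultimately show ?thesis using x by (simp add: \<tau>_def flip_map_def)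
  qed
  have "u x z \<approx> of_bool (x = z) * (1 - q) + of_bool (x = \<tau> z) * q" if x: "x \<in> V" and z: "z \<in> V" for x z
  proof -
    have tau: "x = \<tau> z \<longleftrightarrow> z = \<tau> x" unfolding \<tau>_def using flip_map_flip_map by metis
    consider "z = x" | "z = partner x" "z \<noteq> x" | "z \<noteq> x" "z \<noteq> partner x" by blast
    then show ?thesis
    proof cases
      case 1
      have "1 - flip x \<approx> (1 - q) + of_bool (\<tau> x = x) * q"
        using dich[OF x]
      proof (elim disjE conjE)
        assume "flip x \<approx> 0" "\<tau> x = x"
        then have "1 - flip x \<approx> 1 - 0" by (intro cong_diff cong_refl) simp_all
        then show ?thesis using \<open>\<tau> x = x\<close> by simp
      next
        assume "flip x \<approx> q" "\<tau> x = partner x" "partner x \<noteq> x"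
        then have "1 - flip x \<approx> 1 - q" by (intro cong_diff cong_refl) simp_all
        then show ?thesis using \<open>\<tau> x = partner x\<close> \<open>partner x \<noteq> x\<close> by simp
      qed
      from cong_trans[OF u_diag[OF x] this] show ?thesis using 1 by (simp add: eq_commute)
    next
      case 2
      then have "u x z = flip x" by (simp add: flip_def)
      then show ?thesis using dich[OF x] 2 tau by auto
    next
      case 3
      then have "z \<noteq> \<tau> x" using dich[OF x] by auto
      then show ?thesis using 3 u_zero[OF x z] tau by auto
    qed
  qed
  moreover have "projection q" using flip_projection[OF a(1)] by (simp add: q_def)
  moreover have "\<tau> \<in> graph_auts V A" unfolding \<tau>_def by (rule flip_map_aut[OF nz])
  ultimately show ?thesis by blast
qed

text \<open>
  In the form given by \<open>two_point_form\<close> the generators lie in the span \<open>D\<close> of \<open>1 - q\<close> and \<open>q\<close>, on which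
  multiplication is componentwise; the two components of \<open>a\<close> are its values under the characters of the
  identity and of \<open>\<tau>\<close>.  The factor 2 absorbs the case that these coincide.
\<close>

lemma seminorm_bound:
  assumes a: "a \<in> F"
  shows "p a \<le> 2 * (\<Sum>\<sigma>\<in>graph_auts V A. cmod (perm_eval \<sigma> a))"
proof -
  obtain q \<tau> where q: "projection q" and \<tau>: "\<tau> \<in> graph_auts V A"
    and form: "\<And>x z. x \<in> V \<Longrightarrow> z \<in> V \<Longrightarrow> u x z \<approx> of_bool (x = z) * (1 - q) + of_bool (x = \<tau> z) * q"
    using two_point_form by blast
  define D where "D \<alpha> \<beta> = const_poly \<alpha> * (1 - q) + const_poly \<beta> * q" for \<alpha> \<beta>
  have qF: "q \<in> F" and qq: "q * q \<approx> q" using q by (auto simp: projection_def)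
  have q0: "q - q * q \<approx> 0" using cong_diff[OF cong_refl[OF qF] qq] by simp
  have D_mult: "D \<alpha> \<beta> * D \<gamma> \<delta> \<approx> D (\<alpha> * \<gamma>) (\<beta> * \<delta>)" for \<alpha> \<beta> \<gamma> \<delta>
  proof -
    have cm: "(const_poly c * x) * (const_poly d * y) = const_poly (c * d) * (x * y)" for c d and x y :: "('v \<times> 'v) star_poly"
      unfolding mult.assoc by (subst const_poly_left_commute) (rule const_poly_assoc)
    have "D \<alpha> \<beta> * D \<gamma> \<delta> = const_poly (\<alpha> * \<gamma>) * ((1 - q) * (1 - q)) + const_poly (\<alpha> * \<delta>) * ((1 - q) * q)
        + (const_poly (\<beta> * \<gamma>) * (q * (1 - q)) + const_poly (\<beta> * \<delta>) * (q * q))"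
      by (simp only: D_def distrib_left distrib_right cm add_ac)
    also have "\<dots> \<approx> const_poly (\<alpha> * \<gamma>) * (1 - q) + const_poly (\<alpha> * \<delta>) * 0
        + (const_poly (\<beta> * \<gamma>) * 0 + const_poly (\<beta> * \<delta>) * q)"
      using projection_complement[OF q] q0
      by (intro cong_add cong_mult cong_refl qq) (simp_all add: projection_def algebra_simps)
    finally show ?thesis by (simp add: D_def)
  qed
  have gen: "u x z \<approx> D (of_bool (x = z)) (of_bool (x = \<tau> z))" if "x \<in> V" "z \<in> V" for x z
    using form[OF that] unfolding D_def by (cases "x = z"; cases "x = \<tau> z") simp_all
  have letter: "single [l] 1 \<approx> D (letter_eval (\<lambda>(i, j). of_bool (i = id j)) l) (letter_eval (\<lambda>(i, j). of_bool (i = \<tau> j)) l)"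
    if lV: "gen_of l \<in> V \<times> V" for l
  proof (cases l)
    case (Gen xz)
    then show ?thesis using lV gen by (auto simp: gen_poly_def)
  next
    case (Adj xz)
    obtain x z where xz: "xz = (x, z)" "x \<in> V" "z \<in> V" using lV Adj by auto
    have "single [l] 1 = poly_star (u x z)" by (simp add: Adj xz gen_poly_def)
    also have "\<dots> \<approx> u x z" using u_projection xz by (simp add: projection_def)
    also have "u x z \<approx> D (of_bool (x = z)) (of_bool (x = \<tau> z))" using gen xz by blast
    finally show ?thesis by (simp add: Adj xz cnj_of_bool)
  qed
  have word: "single w 1 \<approx> D (perm_eval id (single w 1)) (perm_eval \<tau> (single w 1))"
    if "\<And>l. l \<in> set w \<Longrightarrow> gen_of l \<in> V \<times> V" for w
    using that
  proof (induction w)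
    case Nil
    show ?case by (simp add: D_def perm_eval_def poly_eval_single one_single[symmetric])
  next
    case (Cons l w)
    have IH: "single w 1 \<approx> D (perm_eval id (single w 1)) (perm_eval \<tau> (single w 1))"
      by (rule Cons.IH) (simp add: Cons.prems)
    have "single (l # w) 1 = single [l] 1 * single w (1::complex)" by (simp add: single_mult)
    also have "\<dots> \<approx> D (letter_eval (\<lambda>(i, j). of_bool (i = id j)) l) (letter_eval (\<lambda>(i, j). of_bool (i = \<tau> j)) l)
       * D (perm_eval id (single w 1)) (perm_eval \<tau> (single w 1))"
      by (rule cong_mult[OF letter IH]) (simp add: Cons.prems)
    also note D_mult
    finally show ?case by (simp add: perm_eval_def poly_eval_single)
  qed
  have "a \<approx> D (perm_eval id a) (perm_eval \<tau> a)"
    using a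
  proof (induction a rule: free_star_induct)
    case (single w c)
    have "const_poly c * single w 1 \<approx> const_poly c * D (perm_eval id (single w 1)) (perm_eval \<tau> (single w 1))"
      using single by (intro cong_mult cong_refl word) simp_all
    also have "\<dots> = D (perm_eval id (single w c)) (perm_eval \<tau> (single w c))"
      by (simp add: D_def distrib_left const_poly_assoc perm_eval_def poly_eval_single)
    also have "const_poly c * single w 1 = single w c" by (simp add: const_poly_def single_mult)
    finally show ?case .
  next
    case (add b c)
    from cong_add[OF this] show ?case
      by (simp add: D_def perm_eval_def const_poly_add distrib_right add_ac)
  qed
  then have "p a = p (D (perm_eval id a) (perm_eval \<tau> a))" by (rule cong_p)
  also have "\<dots> \<le> cmod (perm_eval id a) * p (1 - q) + cmod (perm_eval \<tau> a) * p q"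
    unfolding D_def using qF p_triangle[of "const_poly (perm_eval id a) * (1 - q)" "const_poly (perm_eval \<tau> a) * q"]
    by (simp add: p_scale)
  also have "\<dots> \<le> cmod (perm_eval id a) * 1 + cmod (perm_eval \<tau> a) * 1"
    using projection_norm[OF q] projection_norm[OF projection_complement[OF q]]
    by (intro add_mono mult_left_mono) simp_all
  also have "cmod (perm_eval id a) * 1 \<le> (\<Sum>\<sigma>\<in>graph_auts V A. cmod (perm_eval \<sigma> a))"
    using sum_mono2[OF finite_graph_auts[OF finV], of "{id}" A "\<lambda>\<sigma>. cmod (perm_eval \<sigma> a)"]
    by (simp add: id_in_graph_auts)
  also have "cmod (perm_eval \<tau> a) * 1 \<le> (\<Sum>\<sigma>\<in>graph_auts V A. cmod (perm_eval \<sigma> a))"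
    using sum_mono2[OF finite_graph_auts[OF finV], of "{\<tau>}" A "\<lambda>\<sigma>. cmod (perm_eval \<sigma> a)"]
    by (simp add: \<tau>)
  finally show ?thesis by simp
qed

end

section \<open>Completions determined by finitely many characters\<close>

text \<open>
  The universal seminorm is equivalent to the sum of the absolute values of finitely many characters
  that can take arbitrary prescribed values.  Then Cauchy sequences and null sequences can be recognised
  on the values of the characters, and the completion is \<open>\<complex>\<^sup>S\<close>.
\<close>

locale finitely_evaluated =
  fixes X :: "'x set" and R :: "'x star_poly set" and S :: "'s set" and v :: "'s \<Rightarrow> 'x \<Rightarrow> complex" and K :: real
  assumes finS: "finite S" and S_ne: "S \<noteq> {}" and K: "0 \<le> K"
    and lower: "a \<in> free_star_carrier X \<Longrightarrow> \<sigma> \<in> S \<Longrightarrow> cmod (poly_eval (v \<sigma>) a) \<le> univ_seminorm X R a"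
    and upper: "a \<in> free_star_carrier X \<Longrightarrow> univ_seminorm X R a \<le> K * (\<Sum>\<sigma>\<in>S. cmod (poly_eval (v \<sigma>) a))"
    and interpolate: "\<exists>a\<in>free_star_carrier X. \<forall>\<sigma>\<in>S. poly_eval (v \<sigma>) a = f \<sigma>"
begin

abbreviation F where "F \<equiv> free_star_carrier X"
abbreviation cs where "cs \<equiv> cauchy_seqs X R"
abbreviation U where "U \<equiv> univ_cstar X R"
abbreviation \<C> where "\<C> \<equiv> function_algebra S"

definition limit_value :: "(nat \<Rightarrow> 'x star_poly) \<Rightarrow> 's \<Rightarrow> complex" where
  "limit_value s = (\<lambda>\<sigma>\<in>S. lim (\<lambda>k. poly_eval (v \<sigma>) (s k)))"

lemma univ_nonneg: "a \<in> F \<Longrightarrow> 0 \<le> univ_seminorm X R a"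
  using lower S_ne norm_ge_zero order_trans by blast

lemma cauchy_seqs_iff:
  "s \<in> cs \<longleftrightarrow> range s \<subseteq> F \<and> (\<forall>\<sigma>\<in>S. Cauchy (\<lambda>k. poly_eval (v \<sigma>) (s k)))"
proof (intro iffI conjI ballI)
  assume s: "s \<in> cs"
  then have sF: "range s \<subseteq> F"
    and small: "\<forall>e>0. \<exists>N. \<forall>m\<ge>N. \<forall>k\<ge>N. univ_seminorm X R (s m - s k) < e"
    unfolding cauchy_seqs_def mem_Collect_eq by (rule conjunct1, rule conjunct2)
  show "range s \<subseteq> F" by (rule sF)
  fix \<sigma> assume \<sigma>: "\<sigma> \<in> S"
  show "Cauchy (\<lambda>k. poly_eval (v \<sigma>) (s k))"
  proof (rule CauchyI)
    fix e :: real assume "0 < e"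
    then obtain N where N: "\<And>m k. m \<ge> N \<Longrightarrow> k \<ge> N \<Longrightarrow> univ_seminorm X R (s m - s k) < e"
      using small by meson
    have "cmod (poly_eval (v \<sigma>) (s m) - poly_eval (v \<sigma>) (s k)) < e" if "m \<ge> N" "k \<ge> N" for m k
      using lower[of "s m - s k" \<sigma>] N[OF that] \<sigma> sF[THEN range_subsetD] by simp
    then show "\<exists>M. \<forall>m\<ge>M. \<forall>k\<ge>M. cmod (poly_eval (v \<sigma>) (s m) - poly_eval (v \<sigma>) (s k)) < e" by blast
  qed
next
  assume s: "range s \<subseteq> F \<and> (\<forall>\<sigma>\<in>S. Cauchy (\<lambda>k. poly_eval (v \<sigma>) (s k)))"
  have "\<exists>N. \<forall>m\<ge>N. \<forall>k\<ge>N. univ_seminorm X R (s m - s k) < e" if "0 < e" for e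
  proof -
    define d where "d = e / (K * card S + 1)"
    have pos: "0 < K * card S + 1" using K by (simp add: add_nonneg_pos)
    then have "0 < d" using \<open>0 < e\<close> by (simp add: d_def)
    then have "\<forall>\<sigma>\<in>S. \<exists>N. \<forall>m\<ge>N. \<forall>k\<ge>N. cmod (poly_eval (v \<sigma>) (s m) - poly_eval (v \<sigma>) (s k)) < d"
      using s CauchyD by blast
    then obtain N where N: "\<And>\<sigma> m k. \<sigma> \<in> S \<Longrightarrow> m \<ge> N \<sigma> \<Longrightarrow> k \<ge> N \<sigma> \<Longrightarrow>
        cmod (poly_eval (v \<sigma>) (s m) - poly_eval (v \<sigma>) (s k)) < d"
      by metis
    have le: "N \<sigma> \<le> sum N S" if "\<sigma> \<in> S" for \<sigma> using that finS by (simp add: member_le_sum)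
    have "univ_seminorm X R (s m - s k) < e" if mk: "m \<ge> sum N S" "k \<ge> sum N S" for m k
    proof -
      have "univ_seminorm X R (s m - s k) \<le> K * (\<Sum>\<sigma>\<in>S. cmod (poly_eval (v \<sigma>) (s m - s k)))"
        using s[THEN conjunct1, THEN range_subsetD] by (intro upper) simp
      also have "\<dots> \<le> K * (\<Sum>\<sigma>\<in>S. d)"
      proof (intro mult_left_mono[OF _ K] sum_mono)
        fix \<sigma> assume "\<sigma> \<in> S"
        then show "cmod (poly_eval (v \<sigma>) (s m - s k)) \<le> d"
          using N[of \<sigma> m k] le[of \<sigma>] mk by fastforce
      qed
      also have "\<dots> = (K * card S) * d" by simp
      also have "\<dots> < (K * card S + 1) * d" using \<open>0 < d\<close> by simp
      also have "\<dots> = e" using pos by (simp add: d_def)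
      finally show ?thesis .
    qed
    then show ?thesis by blast
  qed
  then show "s \<in> cs" using s by (simp add: cauchy_seqs_def)
qed

lemma cs_F: "s \<in> cs \<Longrightarrow> s k \<in> F"
  by (auto simp: cauchy_seqs_iff)

lemma limit_value_tendsto:
  "s \<in> cs \<Longrightarrow> \<sigma> \<in> S \<Longrightarrow> (\<lambda>k. poly_eval (v \<sigma>) (s k)) \<longlonglongrightarrow> limit_value s \<sigma>"
  by (simp add: cauchy_seqs_iff limit_value_def Cauchy_convergent_iff convergent_LIMSEQ_iff)

lemma tendsto_imp_cs:
  assumes "\<And>k. r k \<in> F" and lim: "\<And>\<sigma>. \<sigma> \<in> S \<Longrightarrow> (\<lambda>k. poly_eval (v \<sigma>) (r k)) \<longlonglongrightarrow> g \<sigma>"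
  shows "r \<in> cs" and "limit_value r = restrict g S"
proof -
  show "r \<in> cs" using assms LIMSEQ_imp_Cauchy by (fastforce simp: cauchy_seqs_iff)
  show "limit_value r = restrict g S" using limI[OF lim] by (auto simp: limit_value_def)
qed

lemma null_rel_iff: "(s, t) \<in> null_rel X R \<longleftrightarrow> s \<in> cs \<and> t \<in> cs \<and> limit_value s = limit_value t"
proof -
  have "(\<lambda>k. univ_seminorm X R (s k - t k)) \<longlonglongrightarrow> 0 \<longleftrightarrow> limit_value s = limit_value t"
    if s: "s \<in> cs" and t: "t \<in> cs"
  proof
    assume null: "(\<lambda>k. univ_seminorm X R (s k - t k)) \<longlonglongrightarrow> 0"
    have "limit_value s \<sigma> = limit_value t \<sigma>" if \<sigma>: "\<sigma> \<in> S" for \<sigma>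
    proof -
      have "(\<lambda>k. poly_eval (v \<sigma>) (s k - t k)) \<longlonglongrightarrow> 0"
      proof (rule tendsto_0_le[OF null, where K = 1], intro always_eventually allI)
        fix k
        have "cmod (poly_eval (v \<sigma>) (s k - t k)) \<le> univ_seminorm X R (s k - t k)"
          using cs_F[OF s] cs_F[OF t] by (intro lower[OF _ \<sigma>]) simp
        then show "cmod (poly_eval (v \<sigma>) (s k - t k)) \<le> norm (univ_seminorm X R (s k - t k)) * 1" by simp
      qed
      moreover have "(\<lambda>k. poly_eval (v \<sigma>) (s k - t k)) \<longlonglongrightarrow> limit_value s \<sigma> - limit_value t \<sigma>"
        using limit_value_tendsto[OF s \<sigma>] limit_value_tendsto[OF t \<sigma>] by (simp add: tendsto_diff)
      ultimately show ?thesis using LIMSEQ_unique by fastforce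
    qed
    then show "limit_value s = limit_value t" by (auto simp: limit_value_def restrict_def)
  next
    assume eq: "limit_value s = limit_value t"
    have "(\<lambda>k. K * (\<Sum>\<sigma>\<in>S. cmod (poly_eval (v \<sigma>) (s k) - poly_eval (v \<sigma>) (t k))))
        \<longlonglongrightarrow> K * (\<Sum>\<sigma>\<in>S. cmod (limit_value s \<sigma> - limit_value t \<sigma>))"
      using limit_value_tendsto[OF s] limit_value_tendsto[OF t]
      by (intro tendsto_mult tendsto_sum tendsto_norm tendsto_diff tendsto_const)
    then have lim: "(\<lambda>k. K * (\<Sum>\<sigma>\<in>S. cmod (poly_eval (v \<sigma>) (s k) - poly_eval (v \<sigma>) (t k)))) \<longlonglongrightarrow> 0"
      by (simp add: eq)
    show "(\<lambda>k. univ_seminorm X R (s k - t k)) \<longlonglongrightarrow> 0"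
    proof (rule tendsto_0_le[OF lim, where K = 1], intro always_eventually allI)
      fix k
      have "norm (univ_seminorm X R (s k - t k))
          \<le> K * (\<Sum>\<sigma>\<in>S. cmod (poly_eval (v \<sigma>) (s k) - poly_eval (v \<sigma>) (t k)))"
        using upper[of "s k - t k"] univ_nonneg[of "s k - t k"] cs_F[OF s] cs_F[OF t] by simp
      then show "norm (univ_seminorm X R (s k - t k))
          \<le> norm (K * (\<Sum>\<sigma>\<in>S. cmod (poly_eval (v \<sigma>) (s k) - poly_eval (v \<sigma>) (t k)))) * 1" by simp
    qed
  qed
  then show ?thesis unfolding null_rel_def by auto
qed

lemma seq_class_eq: "s \<in> cs \<Longrightarrow> seq_class X R s = {t \<in> cs. limit_value t = limit_value s}"
  by (auto simp: seq_class_def null_rel_iff)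

lemma carrier_U: "c \<in> carrier U \<longleftrightarrow> (\<exists>s\<in>cs. c = seq_class X R s)"
  by (auto simp: univ_cstar_def quotient_def seq_class_def)

lemma seq_repr_class:
  assumes "s \<in> cs"
  shows "seq_repr (seq_class X R s) \<in> cs" and "limit_value (seq_repr (seq_class X R s)) = limit_value s"
proof -
  have "\<exists>t. t \<in> seq_class X R s" using assms by (auto simp: seq_class_eq)
  then have "seq_repr (seq_class X R s) \<in> seq_class X R s" unfolding seq_repr_def by (rule someI_ex)
  then show "seq_repr (seq_class X R s) \<in> cs" "limit_value (seq_repr (seq_class X R s)) = limit_value s"
    using assms by (simp_all add: seq_class_eq)
qed

definition evaluation :: "(nat \<Rightarrow> 'x star_poly) set \<Rightarrow> 's \<Rightarrow> complex" where
  "evaluation c = limit_value (seq_repr c)"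

lemma evaluation_class: "s \<in> cs \<Longrightarrow> evaluation (seq_class X R s) = limit_value s"
  by (simp add: evaluation_def seq_repr_class)

lemma seq_repr_cs: "c \<in> carrier U \<Longrightarrow> seq_repr c \<in> cs"
  using seq_repr_class carrier_U by auto

lemma repr_tendsto:
  "c \<in> carrier U \<Longrightarrow> \<sigma> \<in> S \<Longrightarrow> (\<lambda>k. poly_eval (v \<sigma>) (seq_repr c k)) \<longlonglongrightarrow> evaluation c \<sigma>"
  unfolding evaluation_def by (intro limit_value_tendsto seq_repr_cs)

lemma evaluation_inj: "c \<in> carrier U \<Longrightarrow> d \<in> carrier U \<Longrightarrow> evaluation c = evaluation d \<Longrightarrow> c = d"
  unfolding carrier_U by (elim bexE) (simp add: evaluation_class, simp add: seq_class_eq)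

lemma class_of_tendsto:
  assumes "\<And>k. r k \<in> F" and "\<And>\<sigma>. \<sigma> \<in> S \<Longrightarrow> (\<lambda>k. poly_eval (v \<sigma>) (r k)) \<longlonglongrightarrow> g \<sigma>"
  shows "seq_class X R r \<in> carrier U" and "evaluation (seq_class X R r) = restrict g S"
  using tendsto_imp_cs[of r g, OF assms] by (auto simp: carrier_U evaluation_class)

lemma repr_F: "c \<in> carrier U \<Longrightarrow> seq_repr c k \<in> F"
  by (intro cs_F seq_repr_cs)

lemma U_mult:
  assumes "c \<in> carrier U" "d \<in> carrier U"
  shows "c \<otimes>\<^bsub>U\<^esub> d \<in> carrier U" and "evaluation (c \<otimes>\<^bsub>U\<^esub> d) = evaluation c \<otimes>\<^bsub>\<C>\<^esub> evaluation d"
  using class_of_tendsto[of "\<lambda>k. seq_repr c k * seq_repr d k" "\<lambda>\<sigma>. evaluation c \<sigma> * evaluation d \<sigma>"]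
    repr_F repr_tendsto assms
  by (simp_all add: tendsto_mult) (simp_all add: univ_cstar_def function_algebra_def)

lemma U_add:
  assumes "c \<in> carrier U" "d \<in> carrier U"
  shows "c \<oplus>\<^bsub>U\<^esub> d \<in> carrier U" and "evaluation (c \<oplus>\<^bsub>U\<^esub> d) = evaluation c \<oplus>\<^bsub>\<C>\<^esub> evaluation d"
  using class_of_tendsto[of "\<lambda>k. seq_repr c k + seq_repr d k" "\<lambda>\<sigma>. evaluation c \<sigma> + evaluation d \<sigma>"]
    repr_F repr_tendsto assms
  by (simp_all add: tendsto_add) (simp_all add: univ_cstar_def function_algebra_def)

lemma U_smult:
  assumes "c \<in> carrier U"
  shows "z \<odot>\<^bsub>U\<^esub> c \<in> carrier U" and "evaluation (z \<odot>\<^bsub>U\<^esub> c) = z \<odot>\<^bsub>\<C>\<^esub> evaluation c"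
  using class_of_tendsto[of "\<lambda>k. const_poly z * seq_repr c k" "\<lambda>\<sigma>. z * evaluation c \<sigma>"]
    repr_F repr_tendsto assms
  by (simp_all add: tendsto_mult_left) (simp_all add: univ_cstar_def function_algebra_def)

lemma U_star:
  assumes "c \<in> carrier U"
  shows "star U c \<in> carrier U" and "evaluation (star U c) = star \<C> (evaluation c)"
  using class_of_tendsto[of "\<lambda>k. poly_star (seq_repr c k)" "\<lambda>\<sigma>. cnj (evaluation c \<sigma>)"]
    repr_F repr_tendsto assms
  by (simp_all add: tendsto_cnj) (simp_all add: univ_cstar_def function_algebra_def)

lemma constant_class:
  assumes "a \<in> F"
  shows "seq_class X R (\<lambda>k. a) \<in> carrier U"
    and "evaluation (seq_class X R (\<lambda>k. a)) = (\<lambda>\<sigma>\<in>S. poly_eval (v \<sigma>) a)"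
  using class_of_tendsto[of "\<lambda>k. a" "\<lambda>\<sigma>. poly_eval (v \<sigma>) a"] assms by simp_all

lemma U_one: "\<one>\<^bsub>U\<^esub> \<in> carrier U" "evaluation \<one>\<^bsub>U\<^esub> = \<one>\<^bsub>\<C>\<^esub>"
  using constant_class[of 1] by (simp_all add: univ_cstar_def function_algebra_def)

lemma evaluation_bij: "bij_betw evaluation (carrier U) (carrier \<C>)"
proof (rule bij_betwI')
  fix c d assume "c \<in> carrier U" "d \<in> carrier U"
  then show "evaluation c = evaluation d \<longleftrightarrow> c = d" using evaluation_inj by blast
next
  fix c assume "c \<in> carrier U"
  then show "evaluation c \<in> carrier \<C>"
    by (simp add: evaluation_def limit_value_def function_algebra_def)
next
  fix f assume "f \<in> carrier \<C>"
  then have f: "f \<in> extensional S" by (simp add: function_algebra_def)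
  obtain a where a: "a \<in> F" "\<And>\<sigma>. \<sigma> \<in> S \<Longrightarrow> poly_eval (v \<sigma>) a = f \<sigma>" using interpolate by blast
  have "evaluation (seq_class X R (\<lambda>k. a)) = restrict f S"
    using constant_class(2)[OF a(1)] a(2) by (auto simp: restrict_def)
  then have "f = evaluation (seq_class X R (\<lambda>k. a))" using f by (simp add: extensional_restrict)
  then show "\<exists>c\<in>carrier U. f = evaluation c" using constant_class(1)[OF a(1)] by blast
qed

lemma evaluation_hom: "evaluation \<in> star_hom U \<C>"
  using bij_betw_apply[OF evaluation_bij]
  by (auto simp: star_hom_def ring_hom_def U_mult U_add U_smult U_star U_one)

lemma inverse_hom: "inv_into (carrier U) evaluation \<in> star_hom \<C> U"
proof -
  define \<Psi> where "\<Psi> = inv_into (carrier U) evaluation"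
  have \<Psi>: "\<Psi> f \<in> carrier U" "evaluation (\<Psi> f) = f" if "f \<in> carrier \<C>" for f
    using that bij_betw_imp_surj_on[OF evaluation_bij] by (auto simp: \<Psi>_def inv_into_into f_inv_into_f)
  have eq: "\<Psi> f = c" if "c \<in> carrier U" "evaluation c = f" for f c
    using that bij_betw_imp_inj_on[OF evaluation_bij] by (auto simp: \<Psi>_def)
  have "\<Psi> \<in> star_hom \<C> U"
    unfolding star_hom_def ring_hom_def
  proof (intro CollectI conjI allI impI ballI Pi_I; (elim conjE)?)
    show "\<Psi> f \<in> carrier U" if "f \<in> carrier \<C>" for f using \<Psi>(1)[OF that] .
    show "\<Psi> (f \<otimes>\<^bsub>\<C>\<^esub> g) = \<Psi> f \<otimes>\<^bsub>U\<^esub> \<Psi> g" if "f \<in> carrier \<C>" "g \<in> carrier \<C>" for f g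
      using \<Psi> that U_mult by (intro eq) simp_all
    show "\<Psi> (f \<oplus>\<^bsub>\<C>\<^esub> g) = \<Psi> f \<oplus>\<^bsub>U\<^esub> \<Psi> g" if "f \<in> carrier \<C>" "g \<in> carrier \<C>" for f g
      using \<Psi> that U_add by (intro eq) simp_all
    show "\<Psi> \<one>\<^bsub>\<C>\<^esub> = \<one>\<^bsub>U\<^esub>" using U_one by (intro eq)
    show "\<Psi> (z \<odot>\<^bsub>\<C>\<^esub> f) = z \<odot>\<^bsub>U\<^esub> \<Psi> f" if "f \<in> carrier \<C>" for f z
      using \<Psi> that U_smult by (intro eq) simp_all
    show "\<Psi> (star \<C> f) = star U (\<Psi> f)" if "f \<in> carrier \<C>" for f
      using \<Psi> that U_star by (intro eq) simp_all
  qed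
  then show ?thesis by (simp add: \<Psi>_def)
qed

lemma univ_gen_in: "x \<in> X \<Longrightarrow> univ_gen X R x \<in> carrier U"
  and evaluation_gen: "x \<in> X \<Longrightarrow> evaluation (univ_gen X R x) = (\<lambda>\<sigma>\<in>S. v \<sigma> x)"
  using constant_class[of "gen_poly x"] by (simp_all add: univ_gen_def)

end

section \<open>The quantum automorphism group\<close>

lemma graph_aut_carrier:
  assumes "E \<subseteq> {1..n} \<times> {1..n}"
  shows "carrier (graph_aut n E) = graph_auts {1..n} (\<lambda>i j. (i, j) \<in> E)"
proof -
  have "(\<forall>i\<in>{1..n}. \<forall>j\<in>{1..n}. mat_prod n (perm_matrix \<sigma>) (adj_matrix E) i j =
       (mat_prod n (adj_matrix E) (perm_matrix \<sigma>) i j :: complex)) \<longleftrightarrow>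
     (\<forall>x\<in>{1..n}. \<forall>y\<in>{1..n}. (\<sigma> x, \<sigma> y) \<in> E \<longleftrightarrow> (x, y) \<in> E)" if \<sigma>: "\<sigma> permutes {1..n}" for \<sigma>
  proof -
    have m1: "(mat_prod n (perm_matrix \<sigma>) (adj_matrix E) (\<sigma> x) j :: complex) = of_bool ((x, j) \<in> E)"
      if "x \<in> {1..n}" for x j
    proof -
      have "(mat_prod n (perm_matrix \<sigma>) (adj_matrix E) (\<sigma> x) j :: complex) =
        (\<Sum>k\<in>{1..n}. if k = x then of_bool ((x, j) \<in> E) else 0)"
        unfolding mat_prod_def perm_matrix_def adj_matrix_def
        using inj_eq[OF permutes_inj[OF \<sigma>], of x] by (intro sum.cong) auto
      then show ?thesis using that by simp
    qed
    have m2: "(mat_prod n (adj_matrix E) (perm_matrix \<sigma>) i j :: complex) = of_bool ((i, \<sigma> j) \<in> E)"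
      if "j \<in> {1..n}" for i j
    proof -
      have "(mat_prod n (adj_matrix E) (perm_matrix \<sigma>) i j :: complex) =
        (\<Sum>k\<in>{1..n}. if k = \<sigma> j then of_bool ((i, \<sigma> j) \<in> E) else 0)"
        unfolding mat_prod_def perm_matrix_def adj_matrix_def by (intro sum.cong) auto
      then show ?thesis using permutes_in_image[OF \<sigma>, of j] that by simp
    qed
    have "(\<forall>i\<in>{1..n}. \<forall>j\<in>{1..n}. mat_prod n (perm_matrix \<sigma>) (adj_matrix E) i j =
       (mat_prod n (adj_matrix E) (perm_matrix \<sigma>) i j :: complex)) \<longleftrightarrow>
      (\<forall>i\<in>\<sigma> ` {1..n}. \<forall>j\<in>{1..n}. mat_prod n (perm_matrix \<sigma>) (adj_matrix E) i j =
       (mat_prod n (adj_matrix E) (perm_matrix \<sigma>) i j :: complex))"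
      by (simp only: permutes_image[OF \<sigma>])
    also have "\<dots> \<longleftrightarrow> (\<forall>x\<in>{1..n}. \<forall>j\<in>{1..n}. (x, j) \<in> E \<longleftrightarrow> (\<sigma> x, \<sigma> j) \<in> E)"
      by (simp add: m1 m2 del: atLeastAtMost_iff) blast
    finally show ?thesis by blast
  qed
  then show ?thesis
    unfolding graph_aut_def graph_auts_def sym_group_def by auto
qed

lemma perm_eval_relations:
  assumes \<sigma>: "\<sigma> \<in> carrier (graph_aut n E)" and r: "r \<in> qaut_relations n E"
  shows "perm_eval \<sigma> r = 0"
proof -
  have perm: "\<sigma> permutes {1..n}"
    and comm: "\<And>i j. i \<in> {1..n} \<Longrightarrow> j \<in> {1..n} \<Longrightarrow> mat_prod n (perm_matrix \<sigma>) (adj_matrix E) i j =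
       (mat_prod n (adj_matrix E) (perm_matrix \<sigma>) i j :: complex)"
    using \<sigma> by (auto simp: graph_aut_def sym_group_def)
  have adj: "perm_eval \<sigma> (adj_matrix E i j) = adj_matrix E i j" for i j
    by (simp add: perm_eval_def adj_matrix_def of_bool_def)
  have ev: "perm_eval \<sigma> (a - b) = perm_eval \<sigma> a - perm_eval \<sigma> b"
    "perm_eval \<sigma> (a * b) = perm_eval \<sigma> a * perm_eval \<sigma> b"
    "perm_eval \<sigma> (sum f I) = (\<Sum>i\<in>I. perm_eval \<sigma> (f i))"
    "perm_eval \<sigma> (poly_star a) = cnj (perm_eval \<sigma> a)" "perm_eval \<sigma> 1 = 1" for a b f and I :: "nat set"
    by (simp_all add: perm_eval_def)
  have row: "(\<Sum>k\<in>{1..n}. of_bool (i = \<sigma> k)) = (1::complex)" if "i \<in> {1..n}" for i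
  proof -
    have "(\<Sum>k\<in>{1..n}. of_bool (i = \<sigma> k)) = (\<Sum>k\<in>{1..n}. of_bool (i = k) :: complex)"
      by (rule sum.permute[OF perm, symmetric, unfolded comp_def])
    then show ?thesis using that by (simp add: of_bool_def)
  qed
  have col: "(\<Sum>k\<in>{1..n}. of_bool (k = \<sigma> i)) = (1::complex)" if "i \<in> {1..n}" for i
    using permutes_in_image[OF perm, of i] that by (simp add: of_bool_def)
  show ?thesis
    using r comm row col unfolding qaut_relations_def Let_def
    by (auto simp: ev perm_eval_gen mat_prod_def adj cnj_of_bool perm_matrix_def
        simp del: of_bool_eq_1_iff atLeastAtMost_iff sum_of_bool_eq)
qed

text \<open>
  The product of the generators \<open>(\<sigma> j, j)\<close> over all \<open>j\<close> is the indicator of the permutation \<open>\<sigma>\<close>.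
\<close>

lemma perm_interpolation:
  fixes S :: "(nat \<Rightarrow> nat) set" and n :: nat
  assumes S: "finite S" and perm: "\<And>\<sigma>. \<sigma> \<in> S \<Longrightarrow> \<sigma> permutes {1..n}"
  shows "\<exists>a\<in>free_star_carrier ({1..n} \<times> {1..n}). \<forall>\<sigma>\<in>S. perm_eval \<sigma> a = f \<sigma>"
proof -
  define e where "e \<sigma> = prod_list (map (\<lambda>j. gen_poly (\<sigma> j, j)) [1..<Suc n])" for \<sigma> :: "nat \<Rightarrow> nat"
  have prod_F: "prod_list as \<in> free_star_carrier Y" if "\<And>a. a \<in> set as \<Longrightarrow> a \<in> free_star_carrier Y"
    for as :: "(nat \<times> nat) star_poly list" and Y
    using that by (induction as) simp_all
  have eF: "e \<sigma> \<in> free_star_carrier ({1..n} \<times> {1..n})" if "\<sigma> \<in> S" for \<sigma>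
    unfolding e_def
  proof (rule prod_F)
    fix a assume "a \<in> set (map (\<lambda>j. gen_poly (\<sigma> j, j)) [1..<Suc n])"
    then obtain j where j: "a = gen_poly (\<sigma> j, j)" "j \<in> {1..n}"
      unfolding set_map set_upt atLeastLessThanSuc_atLeastAtMost by blast
    then have "\<sigma> j \<in> {1..n}" using permutes_in_image[OF perm[OF that]] by blast
    then show "a \<in> free_star_carrier ({1..n} \<times> {1..n})"
      unfolding j(1) using j(2) by (intro free_star_gen) blast
  qed
  have ev_list: "perm_eval \<tau> (prod_list as) = prod_list (map (perm_eval \<tau>) as)" for \<tau> and as :: "(nat \<times> nat) star_poly list"
    by (induction as) (simp_all add: perm_eval_def)
  have prod_bool: "prod_list (map (\<lambda>j. of_bool (P j)) js) = (of_bool (\<forall>j\<in>set js. P j) :: complex)" for P and js :: "nat list"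
    by (induction js) auto
  have ev: "perm_eval \<tau> (e \<sigma>) = of_bool (\<sigma> = \<tau>)" if "\<sigma> \<in> S" "\<tau> \<in> S" for \<sigma> \<tau>
  proof -
    have "perm_eval \<tau> (e \<sigma>) = of_bool (\<forall>j\<in>{1..n}. \<sigma> j = \<tau> j)"
      unfolding e_def ev_list map_map comp_def perm_eval_gen prod_bool by (simp add: atLeastLessThanSuc_atLeastAtMost del: upt_Suc)
    moreover have "(\<forall>j\<in>{1..n}. \<sigma> j = \<tau> j) \<longleftrightarrow> \<sigma> = \<tau>"
      using permutes_not_in[OF perm[OF that(1)]] permutes_not_in[OF perm[OF that(2)]] by (metis ext)
    ultimately show ?thesis by simp
  qed
  define a where "a = (\<Sum>\<sigma>\<in>S. const_poly (f \<sigma>) * e \<sigma>)"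
  have "a \<in> free_star_carrier ({1..n} \<times> {1..n})" unfolding a_def using eF by simp
  moreover have "perm_eval \<tau> a = f \<tau>" if "\<tau> \<in> S" for \<tau>
  proof -
    have "perm_eval \<tau> a = (\<Sum>\<sigma>\<in>S. f \<sigma> * perm_eval \<tau> (e \<sigma>))"
      by (simp add: a_def perm_eval_def)
    also have "\<dots> = (\<Sum>\<sigma>\<in>S. if \<sigma> = \<tau> then f \<tau> else 0)"
      using ev that by (intro sum.cong) auto
    finally show ?thesis using S that by simp
  qed
  ultimately show ?thesis by blast
qed

text \<open>
  Both inclusions come from one bijective \<open>*\<close>-homomorphism, the evaluation of the universal algebra at
  the automorphisms, and from its inverse.
\<close>

theorem graph_qaut_eq_graph_aut:
  fixes n :: nat and E :: "(nat \<times> nat) set"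
  assumes n7: "n \<le> 7" and E: "E \<subseteq> {1..n} \<times> {1..n}" and symE: "sym E" and irreflE: "irrefl E"
    and few: "card (carrier (graph_aut n E)) < 3"
  shows "graph_qaut n E =\<^sub>q perm_group_qg n (graph_aut n E)"
proof -
  define V where "V = {1..n}"
  define A where "A = (\<lambda>i j. (i, j) \<in> E)"
  define G where "G = carrier (graph_aut n E)"
  define X where "X = V \<times> V"
  define R where "R = qaut_relations n E"
  define v where "v \<sigma> = (\<lambda>(i, j). of_bool (i = \<sigma> j) :: complex)" for \<sigma> :: "nat \<Rightarrow> nat"
  have G: "G = graph_auts V A" unfolding G_def V_def A_def by (rule graph_aut_carrier[OF E])
  have finV: "finite V" by (simp add: V_def)
  have finG: "finite G" unfolding G using finV by (rule finite_graph_auts)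
  have "G \<noteq> {}" using id_in_graph_auts[of V A] by (auto simp: G)
  have ev: "perm_eval \<sigma> = poly_eval (v \<sigma>)" for \<sigma> by (simp add: perm_eval_def v_def)
  have char_seminorm: "(\<lambda>a. cmod (poly_eval (v \<sigma>) a)) \<in> cstar_seminorms X R" if "\<sigma> \<in> G" for \<sigma>
    using perm_eval_relations[of \<sigma> n E] that by (intro poly_eval_seminorm) (simp add: G_def R_def ev)
  \<comment> \<open>The bound also shows that the supremum defining the universal seminorm is finite.\<close>
  have bound: "p a \<le> 2 * (\<Sum>\<sigma>\<in>G. cmod (poly_eval (v \<sigma>) a))"
    if p: "p \<in> cstar_seminorms X R" and a: "a \<in> free_star_carrier X" for p a
  proof -
    have rel: "p r = 0" if "r \<in> R" for r using p that by (simp add: cstar_seminorms_def)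
    interpret small_magic_seminorm V p A
    proof unfold_locales
      show "p \<in> cstar_seminorms (V \<times> V) {}" using p by (simp add: cstar_seminorms_def X_def)
      show "symp A" using symE by (auto simp: symp_def sym_def A_def)
      show "irreflp A" using irreflE by (auto simp: irreflp_def irrefl_def A_def)
      show "card V \<le> 7" using n7 by (simp add: V_def)
      show "card (graph_auts V A) < 3" using few by (simp add: G[symmetric] G_def)
      show "finite V" by (rule finV)
    next
      fix i j assume ij: "i \<in> V" "j \<in> V"
      show "p (gen_poly (i, j) - poly_star (gen_poly (i, j))) = 0"
        "p (gen_poly (i, j) - gen_poly (i, j) * gen_poly (i, j)) = 0"
        using ij unfolding V_def by (intro rel; unfold R_def qaut_relations_def Let_def; blast)+
      have "mat_prod n (\<lambda>i j. gen_poly (i, j)) (adj_matrix E) i j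
          - mat_prod n (adj_matrix E) (\<lambda>i j. gen_poly (i, j)) i j \<in> R"
        using ij unfolding V_def R_def qaut_relations_def Let_def by blast
      then show "p ((\<Sum>k\<in>V. gen_poly (i, k) * of_bool (A k j)) - (\<Sum>k\<in>V. of_bool (A i k) * gen_poly (k, j))) = 0"
        by (simp add: rel mat_prod_def adj_matrix_def V_def A_def)
    next
      fix i assume i: "i \<in> V"
      show "p ((\<Sum>k\<in>V. gen_poly (i, k)) - 1) = 0" "p ((\<Sum>k\<in>V. gen_poly (k, i)) - 1) = 0"
        using i unfolding V_def by (intro rel; unfold R_def qaut_relations_def Let_def; blast)+
    qed
    show ?thesis using seminorm_bound a by (simp add: G ev X_def)
  qed
  interpret ev: finitely_evaluated X R G v 2
  proof
    show "finite G" "G \<noteq> {}" "(0::real) \<le> 2" by (fact finG, fact, simp)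
    fix a assume a: "a \<in> free_star_carrier X"
    have bdd: "bdd_above ((\<lambda>p. p a) ` cstar_seminorms X R)" using bound[OF _ a] by (intro bdd_aboveI2)
    show "cmod (poly_eval (v \<sigma>) a) \<le> univ_seminorm X R a" if "\<sigma> \<in> G" for \<sigma>
      unfolding univ_seminorm_def using cSUP_upper[OF char_seminorm[OF that] bdd] .
    show "univ_seminorm X R a \<le> 2 * (\<Sum>\<sigma>\<in>G. cmod (poly_eval (v \<sigma>) a))"
      unfolding univ_seminorm_def using bound[OF _ a] char_seminorm \<open>G \<noteq> {}\<close> by (intro cSUP_least) auto
  next
    fix f
    have "\<sigma> permutes {1..n}" if "\<sigma> \<in> G" for \<sigma> using that by (simp add: G graph_auts_def V_def)
    from perm_interpolation[OF finG this] show "\<exists>a\<in>free_star_carrier X. \<forall>\<sigma>\<in>G. poly_eval (v \<sigma>) a = f \<sigma>"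
      by (simp add: X_def V_def ev)
  qed
  let ?\<Phi> = "ev.evaluation" and ?\<Psi> = "inv_into (carrier (univ_cstar X R)) ev.evaluation"
  have q: "qg_size (graph_qaut n E) = n" "qg_algebra (graph_qaut n E) = univ_cstar X R"
    "qg_entry (graph_qaut n E) = (\<lambda>i j. univ_gen X R (i, j))"
    by (simp_all add: graph_qaut_def X_def V_def R_def)
  have g: "qg_size (perm_group_qg n (graph_aut n E)) = n"
    "qg_algebra (perm_group_qg n (graph_aut n E)) = function_algebra G"
    "qg_entry (perm_group_qg n (graph_aut n E)) = (\<lambda>i j. \<lambda>\<sigma>\<in>G. perm_matrix \<sigma> i j)"
    by (simp_all add: perm_group_qg_def G_def)
  have entry: "univ_gen X R (i, j) \<in> carrier (univ_cstar X R)"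
    "?\<Phi> (univ_gen X R (i, j)) = (\<lambda>\<sigma>\<in>G. perm_matrix \<sigma> i j)" if "i \<in> {1..n}" "j \<in> {1..n}" for i j
    using ev.univ_gen_in[of "(i, j)"] ev.evaluation_gen[of "(i, j)"] that
    by (simp_all add: X_def V_def v_def perm_matrix_def)
  have "perm_group_qg n (graph_aut n E) \<subseteq>\<^sub>q graph_qaut n E"
    unfolding qg_subset_def q g
    using ev.evaluation_hom bij_betw_imp_surj_on[OF ev.evaluation_bij] entry by blast
  moreover have "graph_qaut n E \<subseteq>\<^sub>q perm_group_qg n (graph_aut n E)"
    unfolding qg_subset_def q g
  proof (intro conjI bexI[of _ ?\<Psi>] ballI refl)
    show "?\<Psi> \<in> star_hom (function_algebra G) (univ_cstar X R)" by (rule ev.inverse_hom)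
    show "?\<Psi> ` carrier (function_algebra G) = carrier (univ_cstar X R)"
      by (rule bij_betw_imp_surj_on[OF bij_betw_inv_into[OF ev.evaluation_bij]])
    fix i j assume ij: "i \<in> {1..n}" "j \<in> {1..n}"
    show "?\<Psi> (\<lambda>\<sigma>\<in>G. perm_matrix \<sigma> i j) = univ_gen X R (i, j)"
      unfolding entry(2)[OF ij, symmetric]
      by (rule inv_into_f_f[OF bij_betw_imp_inj_on[OF ev.evaluation_bij] entry(1)[OF ij]])
  qed
  ultimately show ?thesis by (simp add: qg_equal_def)
qed

theorem mainTheorem1:
  fixes n :: nat and E :: "(nat \<times> nat) set"
  assumes "n \<le> 7"
    and "E \<subseteq> {1..n} \<times> {1..n}"
    and "sym E"
    and "irrefl E"
  shows "(order (graph_aut n E) = 2 \<longrightarrow> graph_qaut n E =\<^sub>q perm_group_qg n (graph_aut n E)) \<and>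
         (order (graph_aut n E) = 1 \<longrightarrow> graph_qaut n E =\<^sub>q perm_group_qg n (graph_aut n E))"
  using graph_qaut_eq_graph_aut[OF assms] by (simp add: order_def)

end
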